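(* There is a quantum query algorithm that, for every integer $n$ and every function $f:\{0,\dots,n-1\}\times\{0,\dots,n-1\}\to\{0,1\}$, solves the problem $LSQR(f,n)$ (find an empty square of the largest size) with query complexity $O(n^{1.5}\log n\,\log\log n\cdot T_f)$ (as $n\to\infty$) and error probability $0.1$, where $T_f$ is the query complexity of computing $f$.
   Context: Problem $LSQR(f,n)$ (Largest Empty Square): given $f:\{0,\dots,n-1\}^2\to\{0,1\}$, a triple $(x,y,d)$ with $0\le x,y\le n-1$, $1\le d\le n$, $d\le n-x$, $d\le n-y$ is an empty square of size $d$ if $f(i,j)=0$ for all $x\le i\le x+d-1$ and $y\le j\le y+d-1$. The goal is to output an empty square $(x,y,d)$ such that no empty square $(x',y',d')$ has $d'>d$ (if there is no empty square, output $(NULL,NULL,NULL)$). Quantum query model: the input is accessed through the unitary $|i\rangle|z\rangle|w\rangle\mapsto|i\rangle|z+x_i \bmod 2\rangle|w\rangle$, where $x_i$ is the input value with index $i$. An algorithm alternates input-independent unitaries with applications of the query unitary and ends with a measurement; its query complexity is the number of applications of the query unitary. The error probability is the maximum over inputs of the probability that the output is not correct (error probability $0.1$ means at most $0.1$). $T_f$ denotes the query complexity of computing $f$: the number of queries used for one (coherent) evaluation $(i,j)\mapsto f(i,j)$; $T_f=1$ if $f$ itself is the queried input. *)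

theory Defs
  imports
    "Jordan_Normal_Form.Schur_Decomposition"
    "HOL-Library.Landau_Symbols"
begin

definition empty_square :: "nat \<Rightarrow> (nat \<Rightarrow> nat \<Rightarrow> bool) \<Rightarrow> nat \<Rightarrow> nat \<Rightarrow> nat \<Rightarrow> bool" where
  "empty_square n f x y d \<longleftrightarrow>
     x < n \<and> y < n \<and> 1 \<le> d \<and> d \<le> n \<and> d \<le> n - x \<and> d \<le> n - y \<and>
     (\<forall>i\<in>{x..x + d - 1}. \<forall>j\<in>{y..y + d - 1}. \<not> f i j)"

text \<open>The set of correct outputs; \<^term>\<open>None\<close> plays the role of the triple of NULLs.\<close>

definition LSQR :: "(nat \<Rightarrow> nat \<Rightarrow> bool) \<Rightarrow> nat \<Rightarrow> (nat \<times> nat \<times> nat) option set" where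
  "LSQR f n = {out. case out of
       None \<Rightarrow> \<not> (\<exists>x y d. empty_square n f x y d)
     | Some (x, y, d) \<Rightarrow> empty_square n f x y d \<and>
         \<not> (\<exists>x' y' d'. empty_square n f x' y' d' \<and> d' > d)}"

text \<open>
  The input has \<open>N\<close> bits, of which only the values at indices below \<open>N\<close> matter.
  With a workspace of dimension \<open>W\<close> the state space has dimension \<open>N * 2 * W\<close>, and the basis
  state with index register \<open>i < N\<close>, target bit \<open>z < 2\<close> and workspace \<open>w < W\<close> is the unit vector
  with index \<open>(i * 2 + z) * W + w\<close>.
\<close>

definition ket :: "nat \<Rightarrow> nat \<Rightarrow> nat \<Rightarrow> nat \<Rightarrow> nat \<Rightarrow> complex vec" where
  "ket N W i z w = unit_vec (N * 2 * W) ((i * 2 + z) * W + w)"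

text \<open>
  The query unitary, sending \<^term>\<open>ket N W i z w\<close> to
  \<^term>\<open>ket N W i ((z + of_bool (x i)) mod 2) w\<close>: column \<open>c\<close> of the matrix belongs to
  \<open>i = c div W div 2\<close>, \<open>z = c div W mod 2\<close>, \<open>w = c mod W\<close>.
\<close>

definition query_op :: "nat \<Rightarrow> nat \<Rightarrow> (nat \<Rightarrow> bool) \<Rightarrow> complex mat" where
  "query_op N W x = mat (N * 2 * W) (N * 2 * W) (\<lambda>(r, c).
     let i = c div W div 2; z = c div W mod 2; w = c mod W
     in if r = (i * 2 + (z + of_bool (x i)) mod 2) * W + w then 1 else 0)"

definition unitary :: "nat \<Rightarrow> complex mat \<Rightarrow> bool" where
  "unitary d U \<longleftrightarrow>
     U \<in> carrier_mat d d \<and> mat_adjoint U * U = 1\<^sub>m d \<and> U * mat_adjoint U = 1\<^sub>m d"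

text \<open>
  A circuit applies \<open>first_op\<close> and then, for each element of \<open>later_ops\<close> in turn, a query followed
  by that element.
\<close>

record query_circuit =
  work_dim :: nat
  first_op :: "complex mat"
  later_ops :: "complex mat list"

record 'o query_algorithm = query_circuit +
  output_of :: "nat \<Rightarrow> 'o"  \<comment> \<open>output as a function of the index of the measured basis state\<close>

definition queries :: "'a query_circuit_scheme \<Rightarrow> nat" where
  "queries A = length (later_ops A)"

definition valid_circuit :: "nat \<Rightarrow> 'a query_circuit_scheme \<Rightarrow> bool" where
  "valid_circuit N A \<longleftrightarrow> 0 < N \<and> 0 < work_dim A \<and>
     (\<forall>U\<in>insert (first_op A) (set (later_ops A)). unitary (N * 2 * work_dim A) U)"

definition run :: "nat \<Rightarrow> 'a query_circuit_scheme \<Rightarrow> (nat \<Rightarrow> bool) \<Rightarrow> complex vec \<Rightarrow> complex vec" where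
  "run N A x v =
     fold (\<lambda>U u. U *\<^sub>v (query_op N (work_dim A) x *\<^sub>v u)) (later_ops A) (first_op A *\<^sub>v v)"

definition error_prob :: "nat \<Rightarrow> 'o query_algorithm \<Rightarrow> (nat \<Rightarrow> bool) \<Rightarrow> 'o set \<Rightarrow> real" where
  "error_prob N A x correct =
     (\<Sum>k | k < N * 2 * work_dim A \<and> output_of A k \<notin> correct.
        (cmod (run N A x (ket N (work_dim A) 0 0 0) $ k))\<^sup>2)"

text \<open>
  On the \<open>N\<close>-bit input \<open>x\<close>, the circuit acts as \<open>|i,j>|z>|0> \<mapsto> |i,j>|z + f(i,j) mod 2>|0>\<close>.
  These registers are held in its workspace, which factors as
  \<open>{0..<n} \<times> {0..<n} \<times> {0..<2} \<times> {0..<a}\<close> (the last one being ancillas) with index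
  \<open>((i * n + j) * 2 + z) * a + ancilla\<close>; the ancillas and the circuit's own query registers
  start and end in state 0.
\<close>

definition coherently_evaluates ::
  "nat \<Rightarrow> query_circuit \<Rightarrow> (nat \<Rightarrow> bool) \<Rightarrow> nat \<Rightarrow> (nat \<Rightarrow> nat \<Rightarrow> bool) \<Rightarrow> bool" where
  "coherently_evaluates N E x n f \<longleftrightarrow>
     (\<exists>a>0. work_dim E = n * n * 2 * a \<and>
       (\<forall>i<n. \<forall>j<n. \<forall>z<2.
          run N E x (ket N (work_dim E) 0 0 (((i * n + j) * 2 + z) * a)) =
          ket N (work_dim E) 0 0 (((i * n + j) * 2 + (z + of_bool (f i j)) mod 2) * a)))"

text \<open>
  Sanity checks: the query unitary acts as intended, and if the values of \<open>f\<close> themselves are the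
  input bits then one query suffices for a coherent evaluation of \<open>f\<close>.
\<close>

definition map_op :: "nat \<Rightarrow> (nat \<Rightarrow> nat) \<Rightarrow> complex mat" where
  "map_op d p = mat d d (\<lambda>(r, c). if r = p c then 1 else 0)"

lemma map_op_unit_vec:
  assumes "k < d" shows "map_op d p *\<^sub>v unit_vec d k = unit_vec d (p k)"
  using assms by (intro eq_vecI) (auto simp: map_op_def scalar_prod_right_unit, simp add: unit_vec_def)

lemma unitary_map_op:
  assumes p: "\<And>k. k < d \<Longrightarrow> p k < d" and inv: "\<And>k. k < d \<Longrightarrow> p (p k) = k"
  shows "unitary d (map_op d p)"
proof -
  have adj: "mat_adjoint (map_op d p) = map_op d p"
  proof (intro eq_matI)
    fix r c assume "r < dim_row (map_op d p)" "c < dim_col (map_op d p)"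
    then have rc: "r < d" "c < d" by (auto simp: map_op_def)
    have "(c = p r) = (r = p c)" using p inv rc by metis
    then show "mat_adjoint (map_op d p) $$ (r, c) = map_op d p $$ (r, c)"
      using rc by (auto simp: mat_adjoint_def mat_of_rows_def map_op_def)
  qed (auto simp: mat_adjoint_def map_op_def)
  have sq: "map_op d p * map_op d p = 1\<^sub>m d"
  proof (intro eq_matI)
    fix r c assume "r < dim_row (1\<^sub>m d)" "c < dim_col (1\<^sub>m d)"
    then have rc: "r < d" "c < d" by auto
    have "col (map_op d p) c = unit_vec d (p c)"
      using rc by (intro eq_vecI) (auto simp: map_op_def unit_vec_def)
    then have "(map_op d p * map_op d p) $$ (r, c) = (map_op d p *\<^sub>v unit_vec d (p c)) $ r"
      using rc by (simp add: map_op_def)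
    also have "\<dots> = unit_vec d (p (p c)) $ r" using map_op_unit_vec p rc by simp
    finally show "(map_op d p * map_op d p) $$ (r, c) = 1\<^sub>m d $$ (r, c)"
      using rc inv by simp
  qed (auto simp: map_op_def)
  show ?thesis by (simp add: unitary_def adj sq) (simp add: map_op_def)
qed

lemma ket_index_less:
  assumes "i < N" "z < (2::nat)" "w < W" shows "(i * 2 + z) * W + w < N * 2 * W"
proof -
  have "(i * 2 + z) * W + w < (i * 2 + z + 1) * W" using assms by (simp add: algebra_simps)
  also have "\<dots> \<le> (N * 2) * W" using assms by (intro mult_right_mono) auto
  finally show ?thesis .
qed

lemma query_op_eq_map_op:
  "query_op N W x = map_op (N * 2 * W)
     (\<lambda>c. (c div W div 2 * 2 + (c div W mod 2 + of_bool (x (c div W div 2))) mod 2) * W + c mod W)"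
  unfolding query_op_def map_op_def Let_def ..

lemma query_op_ket:
  assumes "i < N" "z < 2" "w < W"
  shows "query_op N W x *\<^sub>v ket N W i z w = ket N W i ((z + of_bool (x i)) mod 2) w"
  using assms ket_index_less[OF assms]
  by (simp add: query_op_eq_map_op ket_def map_op_unit_vec div_add1_eq[of _ w])

lemma unitary_query_op:
  assumes "0 < W" shows "unitary (N * 2 * W) (query_op N W x)"
  unfolding query_op_eq_map_op
proof (rule unitary_map_op)
  fix k assume k: "k < N * 2 * W"
  define i z w where "i = k div W div 2" and "z = k div W mod 2" and "w = k mod W"
  have "i < N" "z < 2" "w < W" using k assms
    by (auto simp: i_def z_def w_def less_mult_imp_div_less)
  have k': "k = (i * 2 + z) * W + w"
    by (simp add: i_def z_def w_def)
  show "(k div W div 2 * 2 + (k div W mod 2 + of_bool (x (k div W div 2))) mod 2) * W + k mod W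
      < N * 2 * W" (is "?p k < _")
    using ket_index_less[OF \<open>i < N\<close> _ \<open>w < W\<close>] by (simp add: i_def w_def)
  have pk: "?p k = (i * 2 + (z + of_bool (x i)) mod 2) * W + w"
    by (simp add: i_def z_def w_def)
  have "z = 0 \<or> z = 1" using \<open>z < 2\<close> by auto
  then have "((z + of_bool (x i)) mod 2 + of_bool (x i)) mod 2 = z" by auto
  then show "(?p k div W div 2 * 2 + (?p k div W mod 2 + of_bool (x (?p k div W div 2))) mod 2) * W
      + ?p k mod W = k"
    unfolding pk using \<open>w < W\<close> by (simp add: k')
qed

definition swap_op :: "nat \<Rightarrow> complex mat" where
  "swap_op m = map_op (m * m) (\<lambda>k. (k mod m) * m + k div m)"

definition direct_circuit :: "nat \<Rightarrow> query_circuit" where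
  "direct_circuit n = (let m = n * n * 2 in
     \<lparr>work_dim = m, first_op = swap_op m, later_ops = [swap_op m]\<rparr>)"

lemma pair_index_less: "r < m \<Longrightarrow> s < m \<Longrightarrow> r * m + s < m * (m::nat)"
proof -
  assume "r < m" "s < m"
  then have "r * m + s < Suc r * m" by simp
  also have "\<dots> \<le> m * m" using \<open>r < m\<close> by (intro mult_right_mono) auto
  finally show ?thesis .
qed

lemma swap_op_unit_vec:
  assumes "r < m" "s < m"
  shows "swap_op m *\<^sub>v unit_vec (m * m) (r * m + s) = unit_vec (m * m) (s * m + r)"
  using assms pair_index_less[OF assms] by (simp add: swap_op_def map_op_unit_vec)

lemma unitary_swap_op: "0 < m \<Longrightarrow> unitary (m * m) (swap_op m)"
  unfolding swap_op_def
  by (rule unitary_map_op) (auto intro!: pair_index_less simp: less_mult_imp_div_less)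

theorem direct_circuit:
  assumes "n \<ge> 1"
  shows "valid_circuit (n * n) (direct_circuit n)"
    and "queries (direct_circuit n) = 1"
    and "coherently_evaluates (n * n) (direct_circuit n) (\<lambda>k. f (k div n) (k mod n)) n f"
proof -
  define m where "m = n * n * 2"
  have m: "0 < m" using assms by (simp add: m_def)
  have circ: "work_dim (direct_circuit n) = m" "first_op (direct_circuit n) = swap_op m"
    "later_ops (direct_circuit n) = [swap_op m]"
    by (simp_all add: direct_circuit_def m_def Let_def)
  show "valid_circuit (n * n) (direct_circuit n)"
    using unitary_swap_op[OF m] m assms
    by (simp add: valid_circuit_def circ) (simp add: m_def)
  show "queries (direct_circuit n) = 1" by (simp add: queries_def circ)
  let ?x = "\<lambda>k. f (k div n) (k mod n)"
  have step: "run (n * n) (direct_circuit n) ?x (ket (n * n) m 0 0 ((i * n + j) * 2 + z)) =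
        ket (n * n) m 0 0 ((i * n + j) * 2 + (z + of_bool (f i j)) mod 2)"
    if ij: "i < n" "j < n" and z: "z < 2" for i j z
  proof -
    have q: "i * n + j < n * n" using pair_index_less ij by simp
    have s: "(i * n + j) * 2 + y < m" if "y < 2" for y using q that by (simp add: m_def)
    have kt: "ket (n * n) m a b w = unit_vec (m * m) ((a * 2 + b) * m + w)" for a b w
      by (simp add: ket_def m_def)
    have sw: "swap_op m *\<^sub>v ket (n * n) m 0 0 ((i * n + j) * 2 + y) = ket (n * n) m (i * n + j) y 0"
      "swap_op m *\<^sub>v ket (n * n) m (i * n + j) y 0 = ket (n * n) m 0 0 ((i * n + j) * 2 + y)"
      if "y < 2" for y
      using swap_op_unit_vec[OF m s[OF that]] swap_op_unit_vec[OF s[OF that] m]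
      by (simp_all add: kt)
    have "f ((i * n + j) div n) ((i * n + j) mod n) = f i j" using ij by simp
    then have "query_op (n * n) m ?x *\<^sub>v ket (n * n) m (i * n + j) z 0 =
        ket (n * n) m (i * n + j) ((z + of_bool (f i j)) mod 2) 0"
      using query_op_ket[OF q z m, of ?x] by simp
    then show ?thesis
      unfolding run_def circ by (simp only: fold_simps sw(1)[OF z] sw(2) mod_less_divisor pos2)
  qed
  show "coherently_evaluates (n * n) (direct_circuit n) ?x n f"
    unfolding coherently_evaluates_def circ using step
    by (intro exI[of _ 1]) (simp only: mult_1_right less_numeral_extra m_def simp_thms, blast)
qed

end

(*
  In the dual adversary bound, a function F has cost c if there are vectors
  u, v with  sum over {i. x i ~= y i} of <u x i, v y i>  equal to 1 if F x ~= F y and 0 otherwise,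
  with squared norms at most c.  Unlike bounded-error algorithms such solutions compose exactly, so
  nesting costs no logarithms: evaluating functions one after the other adds the costs, and finding
  the first true one among m predicates of cost c costs 2 sqrt(m) c.

  For a side length d, every d-square contains a point of the lattice of spacing d.  Around one
  lattice point it suffices to know, in each of fewer than 2d columns, the distance to the nearest
  1 upwards and downwards: cost O(d sqrt d).  Searching the O((n/d)^2) lattice points costs
  O((n/d) d sqrt d) = O(n sqrt n), and binary search over d contributes a factor log n.

  A solution of cost c becomes an algorithm as follows.  With v_x a vector built from u and v, the
  states sqrt(t/K) |F x> + sqrt(1 - t/K) |start> + v_x / sqrt K, for t = 0, ..., K, are such that
  the Gram matrix at time t after a query is the Gram matrix at time t + 1; so some unitary that does
  not depend on x takes each one, after a query, to the next.  Starting without the small part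
  v_x / sqrt K costs error at most 4 |v_x|^2 / K, and K = O(c) iterations suffice.
*)

theory Submission
  imports Defs "HOL-Library.Countable" "HOL-Real_Asymp.Real_Asymp"
begin

section \<open>Dual adversary solutions\<close>

text \<open>Evaluating \<open>G\<close> and then \<open>F\<close> adds costs only if the value of
  \<open>F\<close> determines that of \<open>G\<close>: a pair with equal \<open>F\<close> and
  different \<open>G\<close> would receive 1 from the solution for \<open>G\<close> where 0 is due.
  So every stage returns a transcript (side length, index of a lattice point, all column distances),
  and a transcript is reduced to one bit, at no cost, only where a search or a comparison asks for a
  predicate. Correctness then means that the final transcript determines a valid answer. The bits of
  the adversary problem are the values of \<open>f\<close>, whereas the algorithm queries another
  input and reaches \<open>f\<close> only through the circuit \<open>E\<close>. The action of
  \<open>E\<close> is known only on states with clean ancillas and clean query registers, so all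
  ideal states are placed in that subspace and one run of \<open>E\<close> counts as one query of
  the adversary problem. The vector v_x acts as a catalyst: it is the same before and after an
  iteration. A query lowers the inner product of v_x and v_y by 1 exactly when F x and F y differ,
  and this loss, divided by K, pays for moving weight 1/K from the start state to the
  output.\<close>

definition diff_dot :: "nat \<Rightarrow> (nat \<Rightarrow> bool) \<Rightarrow> (nat \<Rightarrow> bool) \<Rightarrow> (nat \<Rightarrow> real) \<Rightarrow> (nat \<Rightarrow> real) \<Rightarrow> real" where
  "diff_dot M x y a b = (\<Sum>i<M. of_bool (x i \<noteq> y i) * a i * b i)"

definition sq_norm :: "nat \<Rightarrow> (nat \<Rightarrow> real) \<Rightarrow> real" where
  "sq_norm M a = (\<Sum>i<M. (a i)\<^sup>2)"

text \<open>The label \<open>l\<close> turns the number at each input position into a vector with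
  components indexed by \<open>L\<close>. Keeping \<open>u\<close> and \<open>v\<close> apart allows
  different weights and tags on the two sides.\<close>

definition adv_solution ::
  "nat \<Rightarrow> (nat \<Rightarrow> bool) set \<Rightarrow> ((nat \<Rightarrow> bool) \<Rightarrow> 'o) \<Rightarrow> real \<Rightarrow> 'l set \<Rightarrow>
    ((nat \<Rightarrow> bool) \<Rightarrow> 'l \<Rightarrow> nat \<Rightarrow> real) \<Rightarrow> ((nat \<Rightarrow> bool) \<Rightarrow> 'l \<Rightarrow> nat \<Rightarrow> real) \<Rightarrow> bool" where
  "adv_solution M X F c L u v \<longleftrightarrow> finite L \<and>
     (\<forall>x\<in>X. \<forall>y\<in>X. (\<Sum>l\<in>L. diff_dot M x y (u x l) (v y l)) = of_bool (F x \<noteq> F y)) \<and>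
     (\<forall>x\<in>X. (\<Sum>l\<in>L. sq_norm M (u x l)) \<le> c \<and> (\<Sum>l\<in>L. sq_norm M (v x l)) \<le> c)"

definition adv :: "nat \<Rightarrow> (nat \<Rightarrow> bool) set \<Rightarrow> ((nat \<Rightarrow> bool) \<Rightarrow> 'o) \<Rightarrow> real \<Rightarrow> bool" where
  "adv M X F c \<longleftrightarrow> (\<exists>(L :: nat set) u v. adv_solution M X F c L u v)"

lemma sum_Sigma_nested:
  "finite A \<Longrightarrow> (\<And>a. a \<in> A \<Longrightarrow> finite (B a)) \<Longrightarrow>
    sum f (Sigma A B) = (\<Sum>a\<in>A. \<Sum>b\<in>B a. f (a, b))"
  by (simp add: sum.Sigma split_def)

lemma diff_dot_scale: "diff_dot M x y (\<lambda>i. s * a i) (\<lambda>i. t * b i) = s * t * diff_dot M x y a b"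
  by (simp add: diff_dot_def sum_distrib_left mult_ac)

lemma sq_norm_scale: "sq_norm M (\<lambda>i. s * a i) = s\<^sup>2 * sq_norm M a"
  by (simp add: sq_norm_def sum_distrib_left power_mult_distrib)

text \<open>Constructions tag labels with function values, booleans or positions. An injection into
  \<open>nat\<close> brings them back to the one label type over which \<open>adv\<close>
  quantifies.\<close>

lemma advI:
  fixes L :: "'l::countable set"
  assumes "adv_solution M X F c L u v" shows "adv M X F c"
proof -
  have inj: "inj_on to_nat L" by simp
  show ?thesis unfolding adv_def
    apply (rule exI[of _ "to_nat ` L"])
    apply (rule exI[of _ "\<lambda>x l. u x (from_nat l)"])
    apply (rule exI[of _ "\<lambda>x l. v x (from_nat l)"])
    using assms by (simp add: adv_solution_def sum.reindex[OF inj] o_def)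
qed

text \<open>The condition sees a function only through \<open>F x \<noteq> F y\<close>, so only the
  partition of the inputs into value classes matters.\<close>

lemma adv_kernel_cong:
  assumes "adv M X F c" "X' \<subseteq> X" "c \<le> c'"
    and "\<And>x y. x \<in> X' \<Longrightarrow> y \<in> X' \<Longrightarrow> F x = F y \<longleftrightarrow> G x = G y"
  shows "adv M X' G c'"
proof -
  from assms(1) obtain L :: "nat set" and u v where w: "adv_solution M X F c L u v"
    unfolding adv_def by blast
  have "adv_solution M X' G c' L u v"
    unfolding adv_solution_def
  proof (intro conjI ballI)
    show "finite L" using w by (simp add: adv_solution_def)
    fix x assume x: "x \<in> X'"
    then have "(\<Sum>l\<in>L. sq_norm M (u x l)) \<le> c" "(\<Sum>l\<in>L. sq_norm M (v x l)) \<le> c"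
      using w assms(2) unfolding adv_solution_def by auto
    then show "(\<Sum>l\<in>L. sq_norm M (u x l)) \<le> c'" "(\<Sum>l\<in>L. sq_norm M (v x l)) \<le> c'"
      using assms(3) by linarith+
    fix y assume y: "y \<in> X'"
    show "(\<Sum>l\<in>L. diff_dot M x y (u x l) (v y l)) = of_bool (G x \<noteq> G y)"
      using w assms(2) assms(4)[OF x y] x y unfolding adv_solution_def by (simp add: subset_iff)
  qed
  then show ?thesis by (rule advI)
qed

lemma adv_mono: "adv M X F c \<Longrightarrow> X' \<subseteq> X \<Longrightarrow> c \<le> c' \<Longrightarrow> adv M X' F c'"
  by (erule adv_kernel_cong) auto

lemma adv_const:
  assumes "\<And>x y. x \<in> X \<Longrightarrow> y \<in> X \<Longrightarrow> F x = F y" "0 \<le> c"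
  shows "adv M X F c"
proof -
  have "adv_solution M X F c ({} :: nat set) (\<lambda>_ _ _. 0) (\<lambda>_ _ _. 0)"
    unfolding adv_solution_def
  proof (intro conjI ballI)
    fix x y assume "x \<in> X" "y \<in> X"
    then have "F x = F y" by (rule assms(1))
    then show "(\<Sum>l\<in>{}. diff_dot M x y (\<lambda>_. 0) (\<lambda>_. 0)) = of_bool (F x \<noteq> F y)" by simp
  qed (use assms(2) in simp_all)
  then show ?thesis by (rule advI)
qed

lemma adv_query:
  assumes "k < M" shows "adv M X (\<lambda>x. x k) 1"
proof -
  have "adv_solution M X (\<lambda>x. x k) 1 {0::nat} (\<lambda>_ _ i. of_bool (i = k)) (\<lambda>_ _ i. of_bool (i = k))"
    unfolding adv_solution_def
  proof (intro conjI ballI)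
    fix x y :: "nat \<Rightarrow> bool"
    have "diff_dot M x y (\<lambda>i. of_bool (i = k)) (\<lambda>i. of_bool (i = k)) =
        (\<Sum>i<M. if i = k then of_bool (x k \<noteq> y k) else 0)"
      unfolding diff_dot_def by (intro sum.cong) auto
    then show "(\<Sum>l\<in>{0::nat}. diff_dot M x y (\<lambda>i. of_bool (i = k)) (\<lambda>i. of_bool (i = k))) =
        of_bool (x k \<noteq> y k)"
      using assms by simp
  next
    have "sq_norm M (\<lambda>i. of_bool (i = k)) = (\<Sum>i<M. if i = k then 1 else 0)"
      unfolding sq_norm_def by (intro sum.cong) auto
    then show "(\<Sum>l\<in>{0::nat}. sq_norm M (\<lambda>i. of_bool (i = k))) \<le> 1"
      "(\<Sum>l\<in>{0::nat}. sq_norm M (\<lambda>i. of_bool (i = k))) \<le> 1"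
      using assms by simp_all
  qed simp
  then show ?thesis by (rule advI)
qed

text \<open>A pair separated by \<open>G\<close> gets its 1 from the solution for \<open>G\<close>,
  and the tag \<open>g\<close> silences all solutions for \<open>F\<close> on it. A pair with common
  value \<open>g\<close> gets 0 from \<open>G\<close> and the right value from the solution tagged
  \<open>g\<close>. Each input lies in one class only, so a single second solution enters its norm.
  \<open>ref\<close> excludes pairs that \<open>G\<close> separates and \<open>F\<close> does
  not.\<close>

lemma adv_refine:
  fixes G :: "(nat \<Rightarrow> bool) \<Rightarrow> 'g::countable"
  assumes "finite X" and G: "adv M X G c1"
    and F: "\<And>x0. x0 \<in> X \<Longrightarrow> adv M {x \<in> X. G x = G x0} F c2"
    and ref: "\<And>x y. x \<in> X \<Longrightarrow> y \<in> X \<Longrightarrow> F x = F y \<Longrightarrow> G x = G y"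
  shows "adv M X F (c1 + c2)"
proof -
  from G obtain L1 :: "nat set" and u1 v1 where w1: "adv_solution M X G c1 L1 u1 v1"
    unfolding adv_def by blast
  have "\<forall>g\<in>G`X. \<exists>L :: nat set. \<exists>u v. adv_solution M {x \<in> X. G x = g} F c2 L u v"
    using F unfolding adv_def by blast
  then obtain L u v where w: "\<And>g. g \<in> G ` X \<Longrightarrow> adv_solution M {x \<in> X. G x = g} F c2 (L g :: nat set) (u g) (v g)"
    by metis
  let ?L = "L1 <+> (SIGMA g:G`X. L g)"
  define comb :: "_ \<Rightarrow> _ \<Rightarrow> (nat \<Rightarrow> bool) \<Rightarrow> nat + 'g \<times> nat \<Rightarrow> nat \<Rightarrow> real" where
    "comb = (\<lambda>a b x l. case l of Inl l \<Rightarrow> a x l | Inr (g, l) \<Rightarrow> (\<lambda>i. of_bool (G x = g) * b g x l i))"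
  have finL: "finite (L g)" if "g \<in> G ` X" for g
    using w[OF that] by (simp add: adv_solution_def)
  have fin: "finite L1" "finite (SIGMA g:G`X. L g)" "finite (G ` X)"
    using w1 w \<open>finite X\<close> by (auto simp: adv_solution_def)
  have "adv_solution M X F (c1 + c2) ?L (comb u1 u) (comb v1 v)"
    unfolding adv_solution_def
  proof (intro conjI ballI)
    show "finite ?L" using fin by simp
  next
    fix x y assume xy: "x \<in> X" "y \<in> X"
    have "(\<Sum>l\<in>?L. diff_dot M x y (comb u1 u x l) (comb v1 v y l)) =
        (\<Sum>l\<in>L1. diff_dot M x y (u1 x l) (v1 y l)) +
        (\<Sum>g\<in>G`X. of_bool (G x = g) * of_bool (G y = g) * (\<Sum>l\<in>L g. diff_dot M x y (u g x l) (v g y l)))"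
      using fin finL by (simp add: sum.Plus comb_def sum_Sigma_nested diff_dot_scale sum_distrib_left)
    also have "(\<Sum>l\<in>L1. diff_dot M x y (u1 x l) (v1 y l)) = of_bool (G x \<noteq> G y)"
      using w1 xy by (simp add: adv_solution_def)
    also have "(\<Sum>g\<in>G`X. of_bool (G x = g) * of_bool (G y = g) * (\<Sum>l\<in>L g. diff_dot M x y (u g x l) (v g y l)))
       = (\<Sum>g\<in>G`X. if g = G x then of_bool (G x = G y \<and> F x \<noteq> F y) else 0)"
    proof (intro sum.cong refl)
      fix g assume g: "g \<in> G ` X"
      show "of_bool (G x = g) * of_bool (G y = g) * (\<Sum>l\<in>L g. diff_dot M x y (u g x l) (v g y l)) =
        (if g = G x then of_bool (G x = G y \<and> F x \<noteq> F y) else (0::real))"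
        using w[OF g] xy by (auto simp: adv_solution_def)
    qed
    also have "\<dots> = of_bool (G x = G y \<and> F x \<noteq> F y)" using xy fin by simp
    also have "of_bool (G x \<noteq> G y) + \<dots> = (of_bool (F x \<noteq> F y) :: real)"
      using ref[OF xy] by auto
    finally show "(\<Sum>l\<in>?L. diff_dot M x y (comb u1 u x l) (comb v1 v y l)) = of_bool (F x \<noteq> F y)" .
  next
    fix x assume x: "x \<in> X"
    have bound: "(\<Sum>l\<in>?L. sq_norm M (comb a b x l)) \<le> c1 + c2"
      if "(\<Sum>l\<in>L1. sq_norm M (a x l)) \<le> c1" "(\<Sum>l\<in>L (G x). sq_norm M (b (G x) x l)) \<le> c2" for a b
    proof -
      have "(\<Sum>l\<in>?L. sq_norm M (comb a b x l)) = (\<Sum>l\<in>L1. sq_norm M (a x l)) +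
        (\<Sum>g\<in>G`X. (of_bool (G x = g))\<^sup>2 * (\<Sum>l\<in>L g. sq_norm M (b g x l)))"
        using fin finL by (simp add: sum.Plus comb_def sum_Sigma_nested sq_norm_scale sum_distrib_left)
      also have "(\<Sum>g\<in>G`X. (of_bool (G x = g))\<^sup>2 * (\<Sum>l\<in>L g. sq_norm M (b g x l))) =
        (\<Sum>g\<in>G`X. if g = G x then (\<Sum>l\<in>L g. sq_norm M (b g x l)) else 0)"
        by (intro sum.cong) auto
      also have "\<dots> = (\<Sum>l\<in>L (G x). sq_norm M (b (G x) x l))" using x fin by simp
      finally show ?thesis using that by simp
    qed
    show "(\<Sum>l\<in>?L. sq_norm M (comb u1 u x l)) \<le> c1 + c2" "(\<Sum>l\<in>?L. sq_norm M (comb v1 v x l)) \<le> c1 + c2"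
      using w1 w[of "G x"] x by (auto intro!: bound simp: adv_solution_def)
  qed
  then show ?thesis by (rule advI)
qed

text \<open>The tags \<open>P x\<close> and \<open>\<not> P y\<close> annihilate the kernel exactly on the pairs with \<open>P x = P y\<close>.\<close>

lemma adv_predicate:
  fixes P :: "(nat \<Rightarrow> bool) \<Rightarrow> bool"
  assumes F: "adv M X F c" and P: "\<And>x y. x \<in> X \<Longrightarrow> y \<in> X \<Longrightarrow> F x = F y \<Longrightarrow> P x = P y"
  shows "adv M X P c"
proof -
  from F obtain L :: "nat set" and u v where w: "adv_solution M X F c L u v"
    unfolding adv_def by blast
  have "adv_solution M X P c (UNIV \<times> L)
     (\<lambda>x (b, l) i. of_bool (b = P x) * u x l i) (\<lambda>x (b, l) i. of_bool (b \<noteq> P x) * v x l i)"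
    unfolding adv_solution_def
  proof (intro conjI ballI)
    show "finite (UNIV \<times> L :: (bool \<times> nat) set)" using w by (auto simp: adv_solution_def)
  next
    fix x assume x: "x \<in> X"
    show "(\<Sum>l\<in>UNIV \<times> L. sq_norm M (case l of (b, l) \<Rightarrow> \<lambda>i. of_bool (b = P x) * u x l i)) \<le> c"
      "(\<Sum>l\<in>UNIV \<times> L. sq_norm M (case l of (b, l) \<Rightarrow> \<lambda>i. of_bool (b \<noteq> P x) * v x l i)) \<le> c"
      using w x by (cases "P x"; simp add: adv_solution_def sum_Sigma_nested UNIV_bool sq_norm_scale)+
  next
    fix x y assume xy: "x \<in> X" "y \<in> X"
    have "(\<Sum>l\<in>UNIV \<times> L. diff_dot M x y (case l of (b, l) \<Rightarrow> \<lambda>i. of_bool (b = P x) * u x l i)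
       (case l of (b, l) \<Rightarrow> \<lambda>i. of_bool (b \<noteq> P y) * v y l i)) =
       (\<Sum>b\<in>UNIV. of_bool (b = P x) * of_bool (b \<noteq> P y) * (\<Sum>l\<in>L. diff_dot M x y (u x l) (v y l)))"
      using w by (simp add: sum_Sigma_nested diff_dot_scale sum_distrib_left adv_solution_def)
    also have "\<dots> = (\<Sum>b\<in>UNIV. of_bool (b = P x) * of_bool (b \<noteq> P y) * of_bool (F x \<noteq> F y))"
      using w xy by (simp add: adv_solution_def)
    also have "\<dots> = of_bool (P x \<noteq> P y)" using P[OF xy] by (auto simp: UNIV_bool)
    finally show "(\<Sum>l\<in>UNIV \<times> L. diff_dot M x y (case l of (b, l) \<Rightarrow> \<lambda>i. of_bool (b = P x) * u x l i)
       (case l of (b, l) \<Rightarrow> \<lambda>i. of_bool (b \<noteq> P y) * v y l i)) = of_bool (P x \<noteq> P y)" .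
  qed
  then show ?thesis by (rule advI)
qed

section \<open>Search, lists of values and binary search\<close>

definition first_true :: "('x \<Rightarrow> bool) list \<Rightarrow> 'x \<Rightarrow> nat" where
  "first_true gs x = length (takeWhile (\<lambda>g. \<not> g x) gs)"

lemma first_true_le: "first_true gs x \<le> length gs"
  by (simp add: first_true_def length_takeWhile_le)

lemma less_first_true: "k < first_true gs x \<Longrightarrow> \<not> (gs ! k) x"
  unfolding first_true_def by (metis nth_mem set_takeWhileD takeWhile_nth)

lemma nth_first_true: "first_true gs x < length gs \<Longrightarrow> (gs ! first_true gs x) x"
  unfolding first_true_def using nth_length_takeWhile by blast

text \<open>The vectors that give Grover search its square root: positions before the first hit get
  squared weight \<open>1 / s\<close>, the hit gets squared weight \<open>s\<close>.\<close>

lemma adv_first_true: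
  fixes gs :: "((nat \<Rightarrow> bool) \<Rightarrow> bool) list"
  assumes gs: "\<And>g. g \<in> set gs \<Longrightarrow> adv M X g c" and "0 \<le> c" and s: "0 < s" "real (length gs) \<le> s\<^sup>2"
  shows "adv M X (first_true gs) (2 * s * c)"
proof -
  let ?m = "length gs"
  have "\<forall>k<?m. \<exists>L :: nat set. \<exists>u v. adv_solution M X (gs ! k) c L u v"
    using gs unfolding adv_def by simp
  then obtain L u v where w: "\<And>k. k < ?m \<Longrightarrow> adv_solution M X (gs ! k) c (L k :: nat set) (u k) (v k)"
    by metis
  define wt :: "(nat \<Rightarrow> bool) \<Rightarrow> nat \<Rightarrow> bool \<Rightarrow> real" where
    "wt x k b = (if k < first_true gs x \<and> \<not> b then 1 / sqrt s
                else if k = first_true gs x \<and> b then sqrt s else 0)" for x k b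
  define tag where "tag h u x l = (case l of (k, b, l) \<Rightarrow> (\<lambda>i. wt x k (b = h) * u k x l i))"
    for h and u :: "nat \<Rightarrow> (nat \<Rightarrow> bool) \<Rightarrow> nat \<Rightarrow> nat \<Rightarrow> real" and x and l :: "nat \<times> bool \<times> nat"
  let ?L = "SIGMA k:{..<?m}. (UNIV :: bool set) \<times> L k"
  have finL: "finite (L k)" "finite ((UNIV :: bool set) \<times> L k)" if "k < ?m" for k
    using w[OF that] by (auto simp: adv_solution_def)
  have nested: "sum f ?L = (\<Sum>k<?m. \<Sum>b\<in>UNIV. \<Sum>l\<in>L k. f (k, b, l))" for f :: "nat \<times> bool \<times> nat \<Rightarrow> real"
  proof -
    have "sum f ?L = (\<Sum>k<?m. \<Sum>q\<in>UNIV \<times> L k. f (k, q))"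
      by (rule sum_Sigma_nested) (use finL in auto)
    also have "\<dots> = (\<Sum>k<?m. \<Sum>b\<in>UNIV. \<Sum>l\<in>L k. f (k, b, l))"
      by (intro sum.cong refl sum_Sigma_nested) (use finL in auto)
    finally show ?thesis .
  qed
  have bound: "(\<Sum>l\<in>?L. sq_norm M (tag h u x l)) \<le> 2 * s * c"
    if u: "\<And>k. k < ?m \<Longrightarrow> (\<Sum>l\<in>L k. sq_norm M (u k x l)) \<le> c" for h u x
  proof -
    have "(\<Sum>l\<in>?L. sq_norm M (tag h u x l)) =
        (\<Sum>k<?m. \<Sum>b\<in>UNIV. (wt x k (b = h))\<^sup>2 * (\<Sum>l\<in>L k. sq_norm M (u k x l)))"
      by (simp add: nested tag_def sq_norm_scale sum_distrib_left)
    also have "\<dots> \<le> (\<Sum>k<?m. \<Sum>b\<in>UNIV. (wt x k (b = h))\<^sup>2 * c)"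
      using u by (intro sum_mono mult_left_mono) auto
    also have "\<dots> \<le> (\<Sum>k<?m. (1 / s + (if k = first_true gs x then s else 0)) * c)"
      using s \<open>0 \<le> c\<close>
      by (intro sum_mono) (cases h; auto simp: UNIV_bool wt_def power_divide algebra_simps)
    \<comment> \<open>The positions before the hit contribute at most \<open>?m / s\<close>, the hit
      contributes \<open>s\<close>; the hypothesis on \<open>s\<close> bounds the former by
      \<open>s\<close> as well.\<close>
    also have "\<dots> \<le> (?m / s + s) * c"
      unfolding sum_distrib_right[symmetric] sum.distrib
      using s \<open>0 \<le> c\<close> by (intro mult_right_mono) auto
    also have "\<dots> \<le> (s + s) * c"
      using s \<open>0 \<le> c\<close> by (intro mult_right_mono add_mono) (auto simp: divide_simps power2_eq_square)
    finally show ?thesis by simp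
  qed
  have "adv_solution M X (first_true gs) (2 * s * c) ?L (tag True u) (tag False v)"
    unfolding adv_solution_def
  proof (intro conjI ballI)
    show "finite ?L" using finL by auto
  next
    fix x assume x: "x \<in> X"
    show "(\<Sum>l\<in>?L. sq_norm M (tag True u x l)) \<le> 2 * s * c"
      "(\<Sum>l\<in>?L. sq_norm M (tag False v x l)) \<le> 2 * s * c"
      using w x by (auto intro!: bound simp: adv_solution_def)
  next
    fix x y assume xy: "x \<in> X" "y \<in> X"
    let ?a = "first_true gs x" and ?b = "first_true gs y"
    have "(\<Sum>l\<in>?L. diff_dot M x y (tag True u x l) (tag False v y l)) =
       (\<Sum>k<?m. \<Sum>b\<in>UNIV. wt x k b * wt y k (\<not> b) * (\<Sum>l\<in>L k. diff_dot M x y (u k x l) (v k y l)))"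
      by (simp add: nested tag_def
          diff_dot_scale sum_distrib_left)
    \<comment> \<open>Only the earlier of two different hits contributes. There one input carries
      \<open>sqrt s\<close> and the other \<open>1 / sqrt s\<close>, with product 1, and the
      predicate at that position separates the two inputs.\<close>
    also have "\<dots> = (\<Sum>k<?m. if k = min ?a ?b then of_bool (?a \<noteq> ?b) else 0)"
    proof (intro sum.cong refl)
      fix k assume "k \<in> {..<?m}"
      then have k: "k < ?m" by simp
      have "(\<Sum>b\<in>UNIV. wt x k b * wt y k (\<not> b) * (\<Sum>l\<in>L k. diff_dot M x y (u k x l) (v k y l))) =
        (\<Sum>b\<in>UNIV. wt x k b * wt y k (\<not> b)) * of_bool ((gs ! k) x \<noteq> (gs ! k) y)"
        using w[OF k] xy by (simp add: adv_solution_def sum_distrib_right)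
      also have "(\<Sum>b\<in>UNIV. wt x k b * wt y k (\<not> b)) = of_bool (k < ?a \<and> k = ?b \<or> k = ?a \<and> k < ?b)"
        using s by (auto simp: UNIV_bool wt_def)
      also have "\<dots> * of_bool ((gs ! k) x \<noteq> (gs ! k) y) = (if k = min ?a ?b then of_bool (?a \<noteq> ?b) else (0::real))"
        using k less_first_true[of k gs x] less_first_true[of k gs y]
          nth_first_true[of gs x] nth_first_true[of gs y]
        by (auto simp: min_def)
      finally show "(\<Sum>b\<in>UNIV. wt x k b * wt y k (\<not> b) * (\<Sum>l\<in>L k. diff_dot M x y (u k x l) (v k y l))) =
        (if k = min ?a ?b then of_bool (?a \<noteq> ?b) else (0::real))" .
    qed
    also have "\<dots> = of_bool (?a \<noteq> ?b)"
      using first_true_le[of gs x] first_true_le[of gs y] by (auto simp: min_def)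
    finally show "(\<Sum>l\<in>?L. diff_dot M x y (tag True u x l) (tag False v y l)) = of_bool (?a \<noteq> ?b)" .
  qed
  then show ?thesis by (rule advI)
qed

text \<open>The whole list determines its head, so \<open>adv_refine\<close> charges head and tail
  separately; once the head is fixed, list and tail induce the same partition.\<close>

lemma adv_map:
  fixes hs :: "((nat \<Rightarrow> bool) \<Rightarrow> 'g::countable) list" and c :: real
  assumes "finite X" "0 \<le> c" "\<And>h. h \<in> set hs \<Longrightarrow> adv M X h c"
  shows "adv M X (\<lambda>x. map (\<lambda>h. h x) hs) (length hs * c)"
  using assms(3)
proof (induction hs)
  case Nil
  show ?case by (rule adv_const) auto
next
  case (Cons h hs)
  have "adv M X (\<lambda>x. map (\<lambda>h. h x) (h # hs)) (c + length hs * c)"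
  proof (rule adv_refine[where G = h])
    show "adv M {x \<in> X. h x = h x0} (\<lambda>x. map (\<lambda>h. h x) (h # hs)) (length hs * c)" for x0
      by (rule adv_kernel_cong[where F = "\<lambda>x. map (\<lambda>h. h x) hs" and X = X]) (use Cons in auto)
  qed (use Cons assms(1) in auto)
  then show ?case by (simp add: algebra_simps)
qed

text \<open>Every comparison is determined by the final value \<open>D\<close>, as
  \<open>adv_refine\<close> demands. Its answer halves the interval and shrinks the set of inputs,
  which is why both \<open>lo\<close> and \<open>X\<close> vary in the induction.\<close>

lemma adv_binary_search:
  fixes D :: "(nat \<Rightarrow> bool) \<Rightarrow> nat" and c :: real
  assumes "finite X" "0 \<le> c" "\<And>d. adv M X (\<lambda>x. d \<le> D x) c"
  shows "(\<And>x. x \<in> X \<Longrightarrow> lo \<le> D x \<and> D x < lo + 2 ^ k) \<Longrightarrow> adv M X D (k * c)"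
  using assms(1,3)
proof (induction k arbitrary: X lo)
  case 0
  then have "D x = lo" if "x \<in> X" for x using that by fastforce
  then show ?case by (intro adv_const) auto
next
  case (Suc k)
  have "adv M X D (c + k * c)"
  proof (rule adv_refine[where G = "\<lambda>x. lo + 2 ^ k \<le> D x"])
    fix x0 assume "x0 \<in> X"
    let ?X = "{x \<in> X. (lo + 2 ^ k \<le> D x) = (lo + 2 ^ k \<le> D x0)}"
    show "adv M ?X D (k * c)"
    proof (rule Suc.IH[of _ "if lo + 2 ^ k \<le> D x0 then lo + 2 ^ k else lo"])
      fix x assume "x \<in> ?X"
      then show "(if lo + 2 ^ k \<le> D x0 then lo + 2 ^ k else lo) \<le> D x \<and>
          D x < (if lo + 2 ^ k \<le> D x0 then lo + 2 ^ k else lo) + 2 ^ k"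
        using Suc.prems(1)[of x] by auto
    next
      show "adv M ?X (\<lambda>x. d \<le> D x) c" for d by (rule adv_mono[OF Suc.prems(3)]) auto
    qed (use Suc.prems in auto)
  qed (use Suc.prems in auto)
  then show ?case by (simp add: algebra_simps)
qed

section \<open>Adversary cost of the largest empty square\<close>

definition grid :: "nat \<Rightarrow> (nat \<Rightarrow> bool) \<Rightarrow> nat \<Rightarrow> nat \<Rightarrow> bool" where
  "grid n x i j = x (i * n + j)"

text \<open>Towards smaller row indices, with row \<open>p\<close> included. The reading stops at
  the border or after \<open>d\<close> cells, since no square of side \<open>d\<close> through row
  \<open>p\<close> reaches farther.\<close>

definition up_cells :: "nat \<Rightarrow> nat \<Rightarrow> nat \<Rightarrow> nat \<Rightarrow> ((nat \<Rightarrow> bool) \<Rightarrow> bool) list" where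
  "up_cells n d p j = map (\<lambda>t x. grid n x (p - t) j) [0..<min d (p + 1)]"

definition down_cells :: "nat \<Rightarrow> nat \<Rightarrow> nat \<Rightarrow> nat \<Rightarrow> ((nat \<Rightarrow> bool) \<Rightarrow> bool) list" where
  "down_cells n d p j = map (\<lambda>t x. grid n x (p + t) j) [0..<min d (n - p)]"

text \<open>These are the columns, at most 2d - 1, that a square of side \<open>d\<close> through
  column \<open>q\<close> can meet; truncated subtraction cuts the range off at column 0.\<close>

definition window :: "nat \<Rightarrow> nat \<Rightarrow> nat \<Rightarrow> nat list" where
  "window n d q = [q + 1 - d..<min n (q + d)]"

text \<open>The transcript for one lattice point. An entry equal to the length of its list of cells
  records that no 1 is within reach.\<close>

definition extents :: "nat \<Rightarrow> nat \<Rightarrow> nat \<times> nat \<Rightarrow> (nat \<Rightarrow> bool) \<Rightarrow> nat list" where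
  "extents n d = (\<lambda>(p, q) x. map (\<lambda>h. h x)
     (map (\<lambda>j. first_true (up_cells n d p j)) (window n d q) @
      map (\<lambda>j. first_true (down_cells n d p j)) (window n d q)))"

definition square_at :: "nat \<Rightarrow> nat \<Rightarrow> nat \<times> nat \<Rightarrow> nat \<Rightarrow> nat \<Rightarrow> (nat \<Rightarrow> bool) \<Rightarrow> bool" where
  "square_at n d = (\<lambda>(p, q) a b x. empty_square n (grid n x) a b d \<and>
     a \<le> p \<and> p < a + d \<and> b \<le> q \<and> q < b + d)"

text \<open>Absence of hits up to \<open>k\<close> says that the first hit lies beyond
  \<open>k\<close>, which is a property of the value of \<open>first_true\<close> alone.\<close>

lemma first_true_prefix:
  assumes "first_true gs x = first_true gs y" "k < length gs" "\<And>t. t \<le> k \<Longrightarrow> \<not> (gs ! t) x"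
  shows "\<not> (gs ! k) y"
proof -
  have "k < first_true gs x"
  proof (rule ccontr)
    assume "\<not> k < first_true gs x"
    then have "first_true gs x \<le> k" by simp
    then show False using assms(2,3) nth_first_true[of gs x] by fastforce
  qed
  then show ?thesis using assms(1) less_first_true by metis
qed

text \<open>A square through row \<open>p\<close> is empty exactly when, in each of its columns, the
  zeros extend from row \<open>p\<close> up to its top row and down to its bottom row. The recorded
  distances decide this.\<close>

lemma square_at_extents:
  assumes eq: "extents n d (p, q) x = extents n d (p, q) y" and sq: "square_at n d (p, q) a b x"
  shows "square_at n d (p, q) a b y"
proof -
  have pq: "a \<le> p" "p < a + d" "b \<le> q" "q < b + d"
    and es: "empty_square n (grid n x) a b d"
    using sq by (simp_all add: square_at_def)
  have dims: "a < n" "b < n" "1 \<le> d" "d \<le> n" "d \<le> n - a" "d \<le> n - b"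
    and zero: "\<And>i j. a \<le> i \<Longrightarrow> i < a + d \<Longrightarrow> b \<le> j \<Longrightarrow> j < b + d \<Longrightarrow> \<not> grid n x i j"
    using es by (auto simp: empty_square_def)
  have "\<not> grid n y i j" if ij: "a \<le> i" "i < a + d" "b \<le> j" "j < b + d" for i j
  proof -
    have j: "j \<in> set (window n d q)" using ij pq dims by (auto simp: window_def)
    have up: "first_true (up_cells n d p j) x = first_true (up_cells n d p j) y"
      and down: "first_true (down_cells n d p j) x = first_true (down_cells n d p j) y"
      using eq j by (auto simp: extents_def)
    show ?thesis
    proof (cases "i \<le> p")
      case True
      have "\<not> (up_cells n d p j ! (p - i)) y"
      proof (rule first_true_prefix[OF up])
        fix t assume "t \<le> p - i"
        then have "t < min d (p + 1)" "a \<le> p - t" "p - t < a + d" using True ij pq by linarith+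
        then show "\<not> (up_cells n d p j ! t) x" using zero ij by (simp add: up_cells_def del: upt_Suc)
      qed (use True ij pq in \<open>auto simp: up_cells_def\<close>)
      moreover have "p - i < min d (p + 1)" using ij pq by linarith
      ultimately show ?thesis using True by (simp add: up_cells_def del: upt_Suc)
    next
      case False
      have "\<not> (down_cells n d p j ! (i - p)) y"
      proof (rule first_true_prefix[OF down])
        fix t assume "t \<le> i - p"
        then have "t < min d (n - p)" "a \<le> p + t" "p + t < a + d" using False ij pq dims by linarith+
        then show "\<not> (down_cells n d p j ! t) x" using zero ij by (simp add: down_cells_def)
      qed (use False ij pq dims in \<open>auto simp: down_cells_def\<close>)
      moreover have "i - p < min d (n - p)" using False ij pq dims by linarith
      ultimately show ?thesis using False by (simp add: down_cells_def)
    qed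
  qed
  then show ?thesis using pq dims by (auto simp: square_at_def empty_square_def)
qed

lemma adv_extents:
  assumes "finite X" "p < n" "q < n" "1 \<le> d"
  shows "adv (n * n) X (extents n d (p, q)) (8 * real d * sqrt d)"
proof -
  have cell: "adv (n * n) X (\<lambda>x. grid n x i j) 1" if "i < n" "j < n" for i j
    unfolding grid_def using that by (intro adv_query pair_index_less)
  let ?hs = "map (\<lambda>j. first_true (up_cells n d p j)) (window n d q) @
      map (\<lambda>j. first_true (down_cells n d p j)) (window n d q)"
  have "adv (n * n) X (\<lambda>x. map (\<lambda>h. h x) ?hs) (length ?hs * (2 * sqrt d * 1))"
  proof (rule adv_map)
    fix h assume "h \<in> set ?hs"
    then obtain j where j: "j < n" and "h = first_true (up_cells n d p j) \<or> h = first_true (down_cells n d p j)"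
      by (auto simp: window_def)
    then show "adv (n * n) X h (2 * sqrt d * 1)"
    proof (elim disjE ssubst)
      show "adv (n * n) X (first_true (up_cells n d p j)) (2 * sqrt d * 1)"
        by (rule adv_first_true) (use j assms in \<open>auto simp: up_cells_def intro!: cell\<close>)
      show "adv (n * n) X (first_true (down_cells n d p j)) (2 * sqrt d * 1)"
        by (rule adv_first_true) (use j assms in \<open>auto simp: down_cells_def intro!: cell\<close>)
    qed
  qed (use assms in auto)
  moreover have "length ?hs * (2 * sqrt d * 1) \<le> 8 * real d * sqrt d"
  proof -
    \<comment> \<open>Two directions for each of fewer than 2d columns; with
      \<open>2 * sqrt d\<close> for each search this yields the constant 8.\<close>
    have "length ?hs \<le> 4 * d" by (auto simp: window_def)
    then have "length ?hs * (2 * sqrt d) \<le> real (4 * d) * (2 * sqrt d)"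
      by (intro mult_right_mono of_nat_mono) auto
    then show ?thesis by simp
  qed
  ultimately have "adv (n * n) X (\<lambda>x. map (\<lambda>h. h x) ?hs) (8 * real d * sqrt d)"
    by (elim adv_mono) auto
  then show ?thesis by (simp add: extents_def)
qed

section \<open>Lattice points and the search over them\<close>

definition lattice_points :: "nat \<Rightarrow> nat \<Rightarrow> (nat \<times> nat) list" where
  "lattice_points n d = (let ks = [0..<(n - 1) div d + 1] in
     map (\<lambda>(a, b). (a * d, b * d)) (List.product ks ks))"

lemma set_lattice_points:
  "set (lattice_points n d) = (\<lambda>(a, b). (a * d, b * d)) ` ({..(n - 1) div d} \<times> {..(n - 1) div d})"
  by (auto simp: lattice_points_def Let_def atLeast0_lessThan_Suc lessThan_Suc_atMost
      simp flip: atLeast0LessThan)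

text \<open>Rounding a coordinate of the corner up to a multiple of \<open>d\<close> moves it by
  less than \<open>d\<close>, so the lattice point obtained lies inside the square.\<close>

lemma lattice_points_hit:
  assumes "empty_square n (grid n x) a b d"
  shows "\<exists>c \<in> set (lattice_points n d). square_at n d c a b x"
proof -
  have dims: "a < n" "b < n" "1 \<le> d" "d \<le> n" "d \<le> n - a" "d \<le> n - b"
    using assms by (auto simp: empty_square_def)
  define r where "r k = (k + d - 1) div d" for k
  have r: "k \<le> r k * d" "r k * d < k + d" "r k \<le> (n - 1) div d" if "k + d \<le> n" for k
  proof -
    have e: "r k * d + (k + d - 1) mod d = k + d - 1" by (simp add: r_def)
    moreover have "(k + d - 1) mod d < d" using dims by simp
    ultimately show "k \<le> r k * d" "r k * d < k + d" using dims by linarith+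
    show "r k \<le> (n - 1) div d" unfolding r_def using that by (intro div_le_mono) auto
  qed
  have "a + d \<le> n" "b + d \<le> n" using dims by auto
  then have "(r a * d, r b * d) \<in> set (lattice_points n d)" "square_at n d (r a * d, r b * d) a b x"
    using r[of a] r[of b] assms by (auto simp: set_lattice_points square_at_def intro!: image_eqI[of _ _ "(r a, r b)"])
  then show ?thesis by blast
qed

definition contains_square :: "nat \<Rightarrow> nat \<Rightarrow> nat \<times> nat \<Rightarrow> (nat \<Rightarrow> bool) \<Rightarrow> bool" where
  "contains_square n d c x \<longleftrightarrow> (\<exists>a b. square_at n d c a b x)"

definition first_point :: "nat \<Rightarrow> nat \<Rightarrow> (nat \<Rightarrow> bool) \<Rightarrow> nat" where
  "first_point n d = first_true (map (contains_square n d) (lattice_points n d))"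

text \<open>The index stays next to the extents so that the result determines
  \<open>first_point\<close>, the function evaluated before it; the empty list stands for an
  unsuccessful search.\<close>

definition locate :: "nat \<Rightarrow> nat \<Rightarrow> (nat \<Rightarrow> bool) \<Rightarrow> nat \<times> nat list" where
  "locate n d x = (let r = first_point n d x in
     (r, if r < length (lattice_points n d) then extents n d (lattice_points n d ! r) x else []))"

text \<open>The corner is read off from \<open>x\<close> but serves every \<open>y\<close> with the
  same transcript, so it can be computed from the transcript.\<close>

lemma locate_correct:
  assumes "\<exists>a b. empty_square n (grid n x) a b d"
  shows "\<exists>a b. \<forall>y. locate n d y = locate n d x \<longrightarrow> empty_square n (grid n y) a b d"
proof -
  let ?r = "first_point n d x" and ?ps = "lattice_points n d"
  obtain c where "c \<in> set ?ps" "contains_square n d c x"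
    using assms lattice_points_hit unfolding contains_square_def by metis
  then have "?r < length ?ps"
    using less_first_true[of _ "map (contains_square n d) ?ps" x]
      first_true_le[of "map (contains_square n d) ?ps" x]
    unfolding first_point_def in_set_conv_nth by (auto simp: order_less_le)
  moreover from this have "contains_square n d (?ps ! ?r) x"
    using nth_first_true[of "map (contains_square n d) ?ps" x] by (simp add: first_point_def)
  then obtain a b where "square_at n d (?ps ! ?r) a b x" by (auto simp: contains_square_def)
  moreover obtain p q where "?ps ! ?r = (p, q)" by (cases "?ps ! ?r")
  ultimately have "square_at n d (p, q) a b y" if "locate n d y = locate n d x" for y
    using that square_at_extents[of n d p q x y a b] by (auto simp: locate_def Let_def)
  then show ?thesis by (auto simp: square_at_def)
qed

lemma locate_exists:
  assumes "locate n d x = locate n d y" "\<exists>a b. empty_square n (grid n x) a b d"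
  shows "\<exists>a b. empty_square n (grid n y) a b d"
  using locate_correct[OF assms(2)] assms(1) by metis

lemma adv_locate:
  assumes X: "finite X" and d: "1 \<le> d" "d \<le> n"
  shows "adv (n * n) X (locate n d) (40 * real n * sqrt n)"
proof -
  let ?ps = "lattice_points n d"
  define m where "m = (n - 1) div d + 1"
  have "0 < m" by (simp add: m_def)
  have len: "length ?ps = m * m" by (simp add: lattice_points_def m_def Let_def)
  have point: "p < n \<and> q < n" if "(p, q) \<in> set ?ps" for p q
  proof -
    have "k * d < n" if "k < m" for k
    proof -
      have "k * d \<le> (n - 1) div d * d" using that by (simp add: m_def)
      also have "\<dots> \<le> n - 1" by simp
      finally show ?thesis using d by linarith
    qed
    then show ?thesis using that by (auto simp: set_lattice_points m_def)
  qed
  let ?c = "8 * real d * sqrt d"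
  have ext: "adv (n * n) X' (extents n d c) ?c" if "c \<in> set ?ps" "finite X'" for c X'
    using point that d by (cases c) (auto intro!: adv_extents)
  \<comment> \<open>The search needs predicates, so the distances are forgotten here.\<close>
  have "adv (n * n) X (contains_square n d c) ?c" if "c \<in> set ?ps" for c
  proof (rule adv_predicate[OF ext[OF that X]])
    fix x y assume "extents n d c x = extents n d c y"
    then show "contains_square n d c x = contains_square n d c y"
      using square_at_extents unfolding contains_square_def by (metis prod.collapse)
  qed
  then have "adv (n * n) X (first_point n d) (2 * real m * ?c)"
    unfolding first_point_def
    by (intro adv_first_true) (auto simp: len power2_eq_square \<open>0 < m\<close>)
  \<comment> \<open>The search yields only an index. The extents at that one point are evaluated
    once more, which is the additional \<open>?c\<close>.\<close>
  then have "adv (n * n) X (locate n d) (2 * real m * ?c + ?c)"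
  proof (rule adv_refine[OF X])
    fix x0
    let ?r = "first_point n d x0"
    show "adv (n * n) {x \<in> X. first_point n d x = ?r} (locate n d) ?c"
    proof (cases "?r < length ?ps")
      case True
      then show ?thesis
        by (intro adv_kernel_cong[OF ext[of "?ps ! ?r" X]]) (use X in \<open>auto simp: locate_def Let_def\<close>)
    qed (auto intro!: adv_const simp: locate_def Let_def)
  qed (auto simp: locate_def Let_def)
  \<comment> \<open>With \<open>m * d \<le> 2 * n\<close> and \<open>d \<le> n\<close>, the sum 2md
    + d is at most 5n; the factor 8 of \<open>adv_extents\<close> makes this 40.\<close>
  moreover have "2 * real m * ?c + ?c \<le> 40 * real n * sqrt n"
  proof -
    have "m * d \<le> (n - 1) div d * d + d" by (simp add: m_def)
    also have "\<dots> \<le> (n - 1) + n" using d by (intro add_mono) auto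
    finally have md: "m * d \<le> 2 * n" by simp
    have "2 * real m * ?c + ?c = 8 * real (2 * (m * d) + d) * sqrt d" by (simp add: algebra_simps)
    also have "\<dots> \<le> 8 * real (5 * n) * sqrt n"
    proof (intro mult_mono of_nat_mono)
      show "2 * (m * d) + d \<le> 5 * n" using md d by linarith
    qed (use d in auto)
    finally show ?thesis by simp
  qed
  ultimately show ?thesis by (elim adv_mono) auto
qed

section \<open>The side length and the complete transcript\<close>

definition max_side :: "nat \<Rightarrow> (nat \<Rightarrow> bool) \<Rightarrow> nat" where
  "max_side n x = Max (insert 0 {d. \<exists>a b. empty_square n (grid n x) a b d})"

text \<open>A square shrunk towards its corner stays empty, so the attainable sides have no gaps
  above 0, and comparing the maximum with \<open>d\<close> asks for an empty square of side exactly
  \<open>d\<close>.\<close>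

lemma le_max_side_iff:
  "d \<le> max_side n x \<longleftrightarrow> d = 0 \<or> (\<exists>a b. empty_square n (grid n x) a b d)"
proof -
  let ?S = "{d. \<exists>a b. empty_square n (grid n x) a b d}"
  have fin: "finite ?S" by (rule finite_subset[of _ "{..n}"]) (auto simp: empty_square_def)
  have down: "empty_square n (grid n x) a b d" if "empty_square n (grid n x) a b e" "d \<le> e" "d \<noteq> 0" for a b e
    using that by (auto simp: empty_square_def)
  have "d \<le> max_side n x \<longleftrightarrow> (\<exists>e\<in>insert 0 ?S. d \<le> e)"
    unfolding max_side_def using fin by (intro Max_ge_iff) auto
  also have "\<dots> \<longleftrightarrow> d = 0 \<or> d \<in> ?S" using down by blast
  finally show ?thesis by simp
qed

lemma max_side_le: "max_side n x \<le> n"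
  using le_max_side_iff[of "max_side n x" n x] by (auto simp: empty_square_def)

lemma adv_max_side:
  assumes X: "finite X" and k: "n < 2 ^ k"
  shows "adv (n * n) X (max_side n) (real k * (40 * real n * sqrt n))"
proof (rule adv_binary_search[OF X])
  fix d
  show "adv (n * n) X (\<lambda>x. d \<le> max_side n x) (40 * real n * sqrt n)"
  proof (cases "1 \<le> d \<and> d \<le> n")
    case True
    show ?thesis
    proof (rule adv_predicate[OF adv_locate[OF X, of d]])
      fix x y assume "locate n d x = locate n d y"
      then show "(d \<le> max_side n x) = (d \<le> max_side n y)"
        unfolding le_max_side_iff by (metis locate_exists)
    qed (use True in auto)
  next
    case False
    then have "d = 0 \<or> n < d" by auto
    then have "(d \<le> max_side n x) = (d = 0)" for x
      using max_side_le[of n x] by auto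
    then show ?thesis by (intro adv_const) auto
  qed
next
  show "0 \<le> max_side n x \<and> max_side n x < 0 + 2 ^ k" for x
    using max_side_le[of n x] k by simp
qed simp

text \<open>Side 0 means that there is no empty square. A constant then takes the place of
  \<open>locate\<close>, whose cost bound is for sides between 1 and \<open>n\<close>.\<close>

definition solution_data :: "nat \<Rightarrow> (nat \<Rightarrow> bool) \<Rightarrow> nat \<times> nat \<times> nat list" where
  "solution_data n x = (max_side n x, if max_side n x = 0 then (0, []) else locate n (max_side n x) x)"

lemma adv_solution_data:
  assumes X: "finite X" and k: "n < 2 ^ k"
  shows "adv (n * n) X (solution_data n) ((real k + 1) * (40 * real n * sqrt n))"
proof -
  have "adv (n * n) X (solution_data n) (real k * (40 * real n * sqrt n) + 40 * real n * sqrt n)"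
  proof (rule adv_refine[OF X adv_max_side[OF X k]])
    fix x0
    let ?d = "max_side n x0"
    show "adv (n * n) {x \<in> X. max_side n x = ?d} (solution_data n) (40 * real n * sqrt n)"
    proof (cases "?d = 0")
      case False
      then show ?thesis
        by (intro adv_kernel_cong[OF adv_locate[OF X, of ?d n]])
          (auto simp: solution_data_def max_side_le)
    qed (auto intro!: adv_const simp: solution_data_def)
  qed (auto simp: solution_data_def)
  then show ?thesis by (simp add: algebra_simps)
qed

text \<open>All inputs with one transcript share a correct output; a choice of such outputs becomes
  the classical postprocessing of the measured value.\<close>

lemma solution_data_correct:
  "\<exists>out. \<forall>x. solution_data n x = val \<longrightarrow> out \<in> LSQR (grid n x) n"
proof (cases "\<exists>x. solution_data n x = val")
  case True
  then obtain x where x: "solution_data n x = val" by blast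
  let ?d = "max_side n x"
  have best: "d' \<le> max_side n y" if "empty_square n (grid n y) a b d'" for y a b d'
    using that le_max_side_iff by blast
  show ?thesis
  proof (cases "?d = 0")
    case True
    have "None \<in> LSQR (grid n y) n" if "solution_data n y = val" for y
    proof -
      have "max_side n y = 0" using that x True by (auto simp: solution_data_def)
      then show ?thesis using best[of y] by (fastforce simp: LSQR_def empty_square_def)
    qed
    then show ?thesis by blast
  next
    case False
    then have "\<exists>a b. empty_square n (grid n x) a b ?d" using le_max_side_iff[of ?d n x] by simp
    then obtain a b where
      ab: "\<And>y. locate n ?d y = locate n ?d x \<Longrightarrow> empty_square n (grid n y) a b ?d"
      using locate_correct by metis
    have "Some (a, b, ?d) \<in> LSQR (grid n y) n" if "solution_data n y = val" for y
    proof -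
      have y: "max_side n y = ?d" "locate n ?d y = locate n ?d x"
        using that x False by (auto simp: solution_data_def split: if_splits)
      then show ?thesis using ab[of y] best[of y] by (auto simp: LSQR_def not_less)
    qed
    then show ?thesis by blast
  qed
qed auto

section \<open>Unitaries and query circuits\<close>

definition cdot :: "nat \<Rightarrow> complex vec \<Rightarrow> complex vec \<Rightarrow> complex" where
  "cdot d a b = (\<Sum>r<d. cnj (a $ r) * b $ r)"

lemma mat_adjoint_index:
  assumes "A \<in> carrier_mat n m" "i < m" "j < n"
  shows "mat_adjoint A $$ (i, j) = cnj (A $$ (j, i))"
  using assms by (auto simp: mat_adjoint_def mat_of_rows_def)

lemma mat_adjoint_carrier: "A \<in> carrier_mat n m \<Longrightarrow> mat_adjoint A \<in> carrier_mat m n"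
  by (auto simp: mat_adjoint_def)

text \<open>For square matrices a left inverse is a right inverse, so orthonormal columns
  suffice.\<close>

lemma unitary_iff_orthonormal:
  assumes U: "U \<in> carrier_mat d d"
  shows "unitary d U \<longleftrightarrow> (\<forall>i<d. \<forall>j<d. (\<Sum>r<d. cnj (U $$ (r, i)) * U $$ (r, j)) = of_bool (i = j))"
proof -
  have U': "mat_adjoint U \<in> carrier_mat d d" using U by (rule mat_adjoint_carrier)
  have entry: "(mat_adjoint U * U) $$ (i, j) = (\<Sum>r<d. cnj (U $$ (r, i)) * U $$ (r, j))"
    if "i < d" "j < d" for i j
    using U U' that by (simp add: scalar_prod_def mat_adjoint_index[OF U] atLeast0LessThan)
  have "unitary d U \<longleftrightarrow> mat_adjoint U * U = 1\<^sub>m d"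
    using U mat_mult_left_right_inverse[OF U' U] by (auto simp: unitary_def)
  also have "\<dots> \<longleftrightarrow> (\<forall>i<d. \<forall>j<d. (mat_adjoint U * U) $$ (i, j) = of_bool (i = j))"
    using U U' by (auto simp: mat_eq_iff)
  finally show ?thesis by (simp add: entry)
qed

lemma unitary_carrier: "unitary d U \<Longrightarrow> U \<in> carrier_mat d d"
  by (simp add: unitary_def)

lemma mult_mat_vec_index_sum:
  assumes "A \<in> carrier_mat n d" "v \<in> carrier_vec d" "r < n"
  shows "(A *\<^sub>v v) $ r = (\<Sum>c<d. A $$ (r, c) * v $ c)"
  using assms by (auto simp: scalar_prod_def atLeast0LessThan)

lemma unitary_cdot:
  assumes U: "unitary d U" and a: "a \<in> carrier_vec d" and b: "b \<in> carrier_vec d"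
  shows "cdot d (U *\<^sub>v a) (U *\<^sub>v b) = cdot d a b"
proof -
  note Uc = unitary_carrier[OF U]
  have "cdot d (U *\<^sub>v a) (U *\<^sub>v b) =
      (\<Sum>r<d. \<Sum>i<d. \<Sum>j<d. cnj (a $ i) * b $ j * (cnj (U $$ (r, i)) * U $$ (r, j)))"
    unfolding cdot_def
  proof (intro sum.cong refl)
    fix r assume "r \<in> {..<d}"
    then have r: "r < d" by simp
    show "cnj ((U *\<^sub>v a) $ r) * (U *\<^sub>v b) $ r =
        (\<Sum>i<d. \<Sum>j<d. cnj (a $ i) * b $ j * (cnj (U $$ (r, i)) * U $$ (r, j)))"
      unfolding mult_mat_vec_index_sum[OF Uc a r] mult_mat_vec_index_sum[OF Uc b r]
        cnj_sum sum_product complex_cnj_mult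
      by (simp only: mult_ac)
  qed
  also have "\<dots> = (\<Sum>i<d. \<Sum>j<d. cnj (a $ i) * b $ j * (\<Sum>r<d. cnj (U $$ (r, i)) * U $$ (r, j)))"
    unfolding sum_distrib_left
    by (rule trans[OF sum.swap], rule sum.cong[OF refl], rule sum.swap)
  also have "\<dots> = (\<Sum>i<d. \<Sum>j<d. if j = i then cnj (a $ i) * b $ j else 0)"
    using U unfolding unitary_iff_orthonormal[OF Uc] by (intro sum.cong refl) auto
  also have "\<dots> = cdot d a b" by (simp add: cdot_def)
  finally show ?thesis .
qed

lemma unitary_one: "unitary d (1\<^sub>m d)"
  by (subst unitary_iff_orthonormal) (auto simp: if_distrib cong: if_cong)

lemma unitary_mult:
  assumes U: "unitary d U" and V: "unitary d V" shows "unitary d (U * V)"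
proof -
  note Uc = unitary_carrier[OF U] and Vc = unitary_carrier[OF V]
  have UV: "U * V \<in> carrier_mat d d" using Uc Vc by simp
  have "(\<Sum>r<d. cnj ((U * V) $$ (r, i)) * (U * V) $$ (r, j)) = of_bool (i = j)" if "i < d" "j < d" for i j
  proof -
    have col: "(U * V) $$ (r, c) = (U *\<^sub>v col V c) $ r" if "r < d" "c < d" for r c
      using Uc Vc that by simp
    have "(\<Sum>r<d. cnj ((U * V) $$ (r, i)) * (U * V) $$ (r, j)) = cdot d (U *\<^sub>v col V i) (U *\<^sub>v col V j)"
      unfolding cdot_def using col that by (intro sum.cong) auto
    also have "\<dots> = cdot d (col V i) (col V j)" using U Vc by (intro unitary_cdot) auto
    also have "\<dots> = (\<Sum>r<d. cnj (V $$ (r, i)) * V $$ (r, j))"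
      unfolding cdot_def using Vc that by (intro sum.cong) auto
    finally show ?thesis using V that by (simp add: unitary_iff_orthonormal[OF Vc])
  qed
  then show ?thesis by (simp add: unitary_iff_orthonormal[OF UV])
qed

lemma cdot_cnj: "cnj (cdot d a b) = cdot d b a"
  by (simp add: cdot_def mult.commute)

lemma cdot_self: "cdot d a a = complex_of_real (\<Sum>r<d. (cmod (a $ r))\<^sup>2)"
  unfolding cdot_def of_real_sum by (intro sum.cong refl) (simp only: complex_norm_square mult.commute)

lemma cdot_self_eq_0:
  assumes "cdot d w w = 0" "r < d" shows "w $ r = 0"
proof -
  have "(\<Sum>r<d. (cmod (w $ r))\<^sup>2) = 0"
    using assms(1) unfolding cdot_self by (simp only: of_real_eq_0_iff)
  then show ?thesis using assms(2) by (subst (asm) sum_nonneg_eq_0_iff) auto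
qed

text \<open>Generalised Householder reflection \<open>1 - w w\<^sup>* / \<langle>w, a\<rangle>\<close> with \<open>w = a - b\<close>: it is unitary
  because \<open>2 Re \<langle>w, a\<rangle> = \<parallel>w\<parallel>\<^sup>2\<close>.\<close>

lemma unitary_reflection:
  assumes a: "a \<in> carrier_vec d" and b: "b \<in> carrier_vec d" and norm: "cdot d a a = cdot d b b"
  shows "\<exists>U. unitary d U \<and> U *\<^sub>v a = b \<and>
    (\<forall>v\<in>carrier_vec d. cdot d v a = cdot d v b \<longrightarrow> U *\<^sub>v v = v)"
proof -
  define w where "w = a - b"
  have w: "w \<in> carrier_vec d" and wr: "\<And>r. r < d \<Longrightarrow> w $ r = a $ r - b $ r"
    using a b by (auto simp: w_def)
  have dw: "cdot d v w = cdot d v a - cdot d v b" for v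
    by (simp add: cdot_def wr sum_subtractf algebra_simps)
  have wd: "cdot d w v = cdot d a v - cdot d b v" for v
    by (simp add: cdot_def wr sum_subtractf algebra_simps)
  define g where "g = cdot d w a"
  have gg: "g + cnj g = cdot d w w"
    unfolding g_def cdot_cnj by (simp add: dw wd norm)
  show ?thesis
  proof (cases "a = b")
    case True
    then show ?thesis using a by (intro exI[of _ "1\<^sub>m d"]) (auto simp: unitary_one)
  next
    case False
    have ww: "cdot d w w \<noteq> 0"
    proof
      assume "cdot d w w = 0"
      then have "w $ r = 0" if "r < d" for r using cdot_self_eq_0 that by blast
      then have "a = b" using a b wr by (intro eq_vecI) auto
      then show False using False by simp
    qed
    have g0: "g \<noteq> 0" using ww gg by auto
    define U where "U = mat d d (\<lambda>(r, c). of_bool (r = c) - w $ r * cnj (w $ c) / g)"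
    have Uc: "U \<in> carrier_mat d d" by (simp add: U_def)
    have act: "(U *\<^sub>v v) $ r = v $ r - w $ r * cdot d w v / g" if "v \<in> carrier_vec d" "r < d" for v r
    proof -
      have "(U *\<^sub>v v) $ r = (\<Sum>c<d. (if c = r then v $ c else 0) - w $ r / g * (cnj (w $ c) * v $ c))"
        unfolding mult_mat_vec_index_sum[OF Uc that]
        by (intro sum.cong) (use that in \<open>auto simp: U_def algebra_simps\<close>)
      then show ?thesis using that by (simp add: sum_subtractf cdot_def sum_distrib_left sum_divide_distrib)
    qed
    have "unitary d U"
      unfolding unitary_iff_orthonormal[OF Uc]
    proof (intro allI impI)
      fix i j assume ij: "i < d" "j < d"
      have "(\<Sum>r<d. cnj (U $$ (r, i)) * U $$ (r, j)) =
        (\<Sum>r<d. (if r = i then of_bool (i = j) else 0)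
           - (if r = i then w $ r * cnj (w $ j) / g else 0)
           - (if r = j then cnj (w $ r) * w $ i / cnj g else 0)
           + w $ i * cnj (w $ j) / (g * cnj g) * (cnj (w $ r) * w $ r))"
        by (intro sum.cong refl) (use ij g0 in \<open>auto simp: U_def field_simps\<close>)
      also have "\<dots> = of_bool (i = j) - w $ i * cnj (w $ j) / g - cnj (w $ j) * w $ i / cnj g
           + w $ i * cnj (w $ j) / (g * cnj g) * cdot d w w"
        using ij by (simp add: sum.distrib sum_subtractf cdot_def flip: sum_distrib_left sum_divide_distrib)
      \<comment> \<open>Since (g + cnj g) / (g cnj g) = 1 / g + 1 / cnj g, the last term cancels the
        two before it.\<close>
      also have "\<dots> = of_bool (i = j)"
        unfolding gg[symmetric] using g0 by (simp add: field_simps)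
      finally show "(\<Sum>r<d. cnj (U $$ (r, i)) * U $$ (r, j)) = of_bool (i = j)" .
    qed
    moreover have "U *\<^sub>v a = b"
      using Uc a b g0 by (intro eq_vecI) (auto simp: act wr g_def simp del: index_mult_mat_vec)
    moreover have "U *\<^sub>v v = v" if v: "v \<in> carrier_vec d" "cdot d v a = cdot d v b" for v
    proof -
      have "cdot d w v = cnj (cdot d v w)" by (simp add: cdot_cnj)
      then have "cdot d w v = 0" using v by (simp add: dw)
      then show ?thesis using Uc v by (intro eq_vecI) (auto simp: act simp del: index_mult_mat_vec)
    qed
    ultimately show ?thesis by blast
  qed
qed

text \<open>The vectors are matched one at a time. Composing \<open>U\<close> with the reflection
  that takes \<open>U *\<^sub>v a q\<close> to \<open>b q\<close> keeps the earlier matches: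
  equality of the Gram matrices gives each earlier \<open>b s\<close> the same inner product with
  these two vectors, so the reflection fixes it. Vectors may be dependent and of any norm.\<close>

lemma unitary_of_gram:
  assumes "finite S" "\<And>s. s \<in> S \<Longrightarrow> a s \<in> carrier_vec d" "\<And>s. s \<in> S \<Longrightarrow> b s \<in> carrier_vec d"
    and "\<And>s t. s \<in> S \<Longrightarrow> t \<in> S \<Longrightarrow> cdot d (a s) (a t) = cdot d (b s) (b t)"
  shows "\<exists>U. unitary d U \<and> (\<forall>s\<in>S. U *\<^sub>v a s = b s)"
  using assms
proof (induction S rule: finite_induct)
  case empty
  show ?case using unitary_one by blast
next
  case (insert q S)
  then obtain U where U: "unitary d U" and US: "\<And>s. s \<in> S \<Longrightarrow> U *\<^sub>v a s = b s" by auto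
  note Uc = unitary_carrier[OF U]
  have aq: "a q \<in> carrier_vec d" and bq: "b q \<in> carrier_vec d" using insert.prems by auto
  have Uaq: "U *\<^sub>v a q \<in> carrier_vec d" using Uc aq by simp
  have "cdot d (U *\<^sub>v a q) (U *\<^sub>v a q) = cdot d (b q) (b q)"
    using unitary_cdot[OF U aq aq] insert.prems by simp
  from unitary_reflection[OF Uaq bq this] obtain V where V: "unitary d V" "V *\<^sub>v (U *\<^sub>v a q) = b q"
    and fixed: "\<And>v. v \<in> carrier_vec d \<Longrightarrow> cdot d v (U *\<^sub>v a q) = cdot d v (b q) \<Longrightarrow> V *\<^sub>v v = v" by blast
  note Vc = unitary_carrier[OF V(1)]
  have "(V * U) *\<^sub>v a s = b s" if s: "s \<in> insert q S" for s
  proof (cases "s = q")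
    case True
    then show ?thesis using V(2) assoc_mult_mat_vec[OF Vc Uc aq] by simp
  next
    case False
    then have sS: "s \<in> S" using s by simp
    have as: "a s \<in> carrier_vec d" "b s \<in> carrier_vec d" using insert.prems sS by auto
    have "cdot d (b s) (U *\<^sub>v a q) = cdot d (U *\<^sub>v a s) (U *\<^sub>v a q)" using US[OF sS] by simp
    also have "\<dots> = cdot d (b s) (b q)" using unitary_cdot[OF U as(1) aq] insert.prems sS by simp
    finally have "V *\<^sub>v b s = b s" using fixed as by blast
    then show ?thesis using US[OF sS] assoc_mult_mat_vec[OF Vc Uc as(1)] by simp
  qed
  then show ?case using unitary_mult[OF V(1) U] by blast
qed

section \<open>Circuits as matrices depending on the input\<close>

definition circuit_mat :: "nat \<Rightarrow> nat \<Rightarrow> complex mat \<Rightarrow> complex mat list \<Rightarrow> (nat \<Rightarrow> bool) \<Rightarrow> complex mat" where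
  "circuit_mat N W F L x = fold (\<lambda>U A. U * (query_op N W x * A)) L F"

text \<open>The operators, as functions of the input, that some circuit with \<open>T\<close>
  queries implements exactly. Closure under products allows an algorithm to be assembled without
  handling lists of operators.\<close>

definition realizable :: "nat \<Rightarrow> nat \<Rightarrow> nat \<Rightarrow> ((nat \<Rightarrow> bool) \<Rightarrow> complex mat) \<Rightarrow> bool" where
  "realizable N W T R \<longleftrightarrow> (\<exists>F L. (\<forall>U\<in>insert F (set L). unitary (N * 2 * W) U) \<and> length L = T \<and>
     (\<forall>x. R x = circuit_mat N W F L x))"

lemma query_op_carrier: "query_op N W x \<in> carrier_mat (N * 2 * W) (N * 2 * W)"
  by (simp add: query_op_def)

lemma unitary_circuit_mat:
  assumes "0 < W" "unitary (N * 2 * W) F" "\<forall>U\<in>set L. unitary (N * 2 * W) U"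
  shows "unitary (N * 2 * W) (circuit_mat N W F L x)"
  using assms(2,3) unfolding circuit_mat_def
  by (induction L arbitrary: F) (auto intro!: unitary_mult unitary_query_op[OF assms(1)])

lemma realizable_unitary: "0 < W \<Longrightarrow> realizable N W T R \<Longrightarrow> unitary (N * 2 * W) (R x)"
  unfolding realizable_def by (auto intro: unitary_circuit_mat)

lemma circuit_mat_mult:
  assumes "F \<in> carrier_mat d d" "B \<in> carrier_mat d d" "d = N * 2 * W"
    "\<forall>U\<in>set L. U \<in> carrier_mat d d"
  shows "circuit_mat N W (F * B) L x = circuit_mat N W F L x * B"
  using assms(1,4)
proof (induction L arbitrary: F)
  case (Cons U L)
  have Q: "query_op N W x \<in> carrier_mat d d" using assms(3) by (simp add: query_op_carrier)
  have "U * (query_op N W x * F) \<in> carrier_mat d d"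
    using Cons.prems Q by (auto intro!: mult_carrier_mat)
  moreover have "U * (query_op N W x * (F * B)) = U * (query_op N W x * F) * B"
    using Cons.prems Q assms(2) by (simp add: assoc_mult_mat[of _ d d _ d _ d])
  ultimately show ?case using Cons.IH[of "U * (query_op N W x * F)"] Cons.prems
    by (simp add: circuit_mat_def)
qed (simp add: circuit_mat_def)

lemma realizable_const: "unitary (N * 2 * W) U \<Longrightarrow> realizable N W 0 (\<lambda>_. U)"
  unfolding realizable_def by (intro exI[of _ U] exI[of _ "[]"]) (simp add: circuit_mat_def)

text \<open>The last operator of the first circuit and the first operator of the second are adjacent
  and independent of the input, so they merge into one and the query counts simply add.\<close>

lemma realizable_mult:
  assumes W: "0 < W" and R: "realizable N W T R" and R': "realizable N W T' R'"
  shows "realizable N W (T + T') (\<lambda>x. R' x * R x)"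
proof -
  define d where "d = N * 2 * W"
  obtain F L where U: "\<And>U. U \<in> insert F (set L) \<Longrightarrow> unitary d U"
    and L: "length L = T" "\<And>x. R x = circuit_mat N W F L x"
    using R unfolding realizable_def d_def by blast
  obtain F' L' where U': "\<And>U. U \<in> insert F' (set L') \<Longrightarrow> unitary d U"
    and L': "length L' = T'" "\<And>x. R' x = circuit_mat N W F' L' x"
    using R' unfolding realizable_def d_def by blast
  have F'c: "F' \<in> carrier_mat d d" and L'c: "\<forall>U\<in>set L'. U \<in> carrier_mat d d"
    using U' by (auto intro: unitary_carrier)
  have Rc: "R x \<in> carrier_mat d d" for x
    using realizable_unitary[OF W R] by (auto simp: d_def intro: unitary_carrier)
  have comp: "circuit_mat N W (F' * R x) L' x = R' x * R x" for x
    using circuit_mat_mult[OF F'c Rc d_def L'c] L'(2) by simp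
  show ?thesis
  proof (cases L rule: rev_cases)
    case Nil
    then have "R x = F" for x using L(2) by (simp add: circuit_mat_def)
    then show ?thesis
      unfolding realizable_def using U U' L L' Nil comp
      by (intro exI[of _ "F' * F"] exI[of _ L']) (auto simp: d_def[symmetric] intro!: unitary_mult)
  next
    case (snoc L0 V)
    have step: "R x = V * (query_op N W x * circuit_mat N W F L0 x)" for x
      using L(2) snoc by (simp add: circuit_mat_def)
    have L0: "circuit_mat N W F L0 x \<in> carrier_mat d d" for x
      unfolding d_def by (rule unitary_carrier, rule unitary_circuit_mat)
        (use U W snoc in \<open>auto simp: d_def\<close>)
    have V: "V \<in> carrier_mat d d" using U snoc by (auto intro: unitary_carrier)
    have Q: "query_op N W x \<in> carrier_mat d d" for x by (simp add: d_def query_op_carrier)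
    have "circuit_mat N W F (L0 @ [F' * V] @ L') x = R' x * R x" for x
    proof -
      have "circuit_mat N W F (L0 @ [F' * V] @ L') x =
        circuit_mat N W (F' * V * (query_op N W x * circuit_mat N W F L0 x)) L' x"
        by (simp add: circuit_mat_def)
      also have "F' * V * (query_op N W x * circuit_mat N W F L0 x) = F' * R x"
        unfolding step using F'c V Q[of x] L0[of x] by (simp add: assoc_mult_mat[of _ d d _ d _ d])
      finally show ?thesis by (simp add: comp)
    qed
    then show ?thesis
      unfolding realizable_def using U U' L L' snoc
      by (intro exI[of _ F] exI[of _ "L0 @ [F' * V] @ L'"])
        (auto simp: d_def[symmetric] intro!: unitary_mult)
  qed
qed

lemma run_eq_circuit_mat:
  assumes A: "valid_circuit N A" and v: "v \<in> carrier_vec (N * 2 * work_dim A)"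
  shows "run N A x v = circuit_mat N (work_dim A) (first_op A) (later_ops A) x *\<^sub>v v"
proof -
  define d where "d = N * 2 * work_dim A"
  have Q: "query_op N (work_dim A) x \<in> carrier_mat d d" by (simp add: d_def query_op_carrier)
  have "fold (\<lambda>U u. U *\<^sub>v (query_op N (work_dim A) x *\<^sub>v u)) L (F *\<^sub>v v) =
      fold (\<lambda>U A'. U * (query_op N (work_dim A) x * A')) L F *\<^sub>v v"
    if "\<forall>U\<in>set L. U \<in> carrier_mat d d" "F \<in> carrier_mat d d" for L F
    using that
  proof (induction L arbitrary: F)
    case (Cons U L)
    have "U * (query_op N (work_dim A) x * F) \<in> carrier_mat d d"
      using Cons.prems Q by (auto intro!: mult_carrier_mat)
    moreover have "U *\<^sub>v (query_op N (work_dim A) x *\<^sub>v (F *\<^sub>v v)) = (U * (query_op N (work_dim A) x * F)) *\<^sub>v v"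
      using Cons.prems Q v by (simp add: assoc_mult_mat_vec[of _ d d _ d] d_def)
    ultimately show ?case using Cons.IH[of "U * (query_op N (work_dim A) x * F)"] Cons.prems by simp
  qed simp
  then show ?thesis
    unfolding run_def circuit_mat_def using A
    by (auto simp: valid_circuit_def d_def intro: unitary_carrier)
qed

section \<open>Enlarged workspaces: the tensor product with an identity on a new lowest digit of the
  index\<close>

definition tensor_id :: "nat \<Rightarrow> complex mat \<Rightarrow> complex mat" where
  "tensor_id w A = mat (dim_row A * w) (dim_col A * w)
     (\<lambda>(r, c). if r mod w = c mod w then A $$ (r div w, c div w) else 0)"

lemma sum_lessThan_mult:
  fixes f :: "nat \<Rightarrow> 'a::comm_monoid_add"
  shows "(\<Sum>r<d * w. f r) = (\<Sum>a<d. \<Sum>b<w. f (a * w + b))"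
proof -
  have "(\<Sum>r<d * w. f r) = (\<Sum>a<d. sum f {a * w..<a * w + w})" by (rule sum.nat_group[symmetric])
  also have "\<dots> = (\<Sum>a<d. \<Sum>b<w. f (a * w + b))"
    using sum.shift_bounds_nat_ivl[of f 0 "_ * w" w]
    by (intro sum.cong[OF refl]) (simp add: atLeast0LessThan add.commute)
  finally show ?thesis .
qed

lemma tensor_id_carrier: "A \<in> carrier_mat d d \<Longrightarrow> tensor_id w A \<in> carrier_mat (d * w) (d * w)"
  by (auto simp: tensor_id_def)

lemma tensor_id_index:
  assumes "A \<in> carrier_mat d d" "r < d * w" "c < d * w"
  shows "tensor_id w A $$ (r, c) = (if r mod w = c mod w then A $$ (r div w, c div w) else 0)"
  using assms by (auto simp: tensor_id_def)

lemma tensor_id_mult: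
  assumes A: "A \<in> carrier_mat d d" and B: "B \<in> carrier_mat d d" and w: "0 < w"
  shows "tensor_id w (A * B) = tensor_id w A * tensor_id w B"
proof (rule eq_matI)
  have AB: "A * B \<in> carrier_mat d d" using A B by simp
  fix r c assume "r < dim_row (tensor_id w A * tensor_id w B)" "c < dim_col (tensor_id w A * tensor_id w B)"
  then have rc: "r < d * w" "c < d * w" using tensor_id_carrier[OF A, of w] tensor_id_carrier[OF B, of w] by auto
  then have rc': "r div w < d" "c div w < d" "r mod w < w" "c mod w < w" using w by (auto simp: less_mult_imp_div_less)
  have "(tensor_id w A * tensor_id w B) $$ (r, c) =
      (\<Sum>k<d * w. tensor_id w A $$ (r, k) * tensor_id w B $$ (k, c))"
    using rc tensor_id_carrier[OF A, of w] tensor_id_carrier[OF B, of w] by (simp add: scalar_prod_def atLeast0LessThan)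
  also have "\<dots> = (\<Sum>k<d. \<Sum>b<w. tensor_id w A $$ (r, k * w + b) * tensor_id w B $$ (k * w + b, c))"
    by (rule sum_lessThan_mult)
  also have "\<dots> = (\<Sum>k<d. \<Sum>b<w. if b = c mod w then
      (if r mod w = c mod w then A $$ (r div w, k) * B $$ (k, c div w) else 0) else 0)"
  proof (intro sum.cong refl)
    fix k b assume kb: "k \<in> {..<d}" "b \<in> {..<w}"
    then have "k * w + b < Suc k * w" by simp
    also have "\<dots> \<le> d * w" using kb by (intro mult_right_mono) auto
    finally have "k * w + b < d * w" .
    then show "tensor_id w A $$ (r, k * w + b) * tensor_id w B $$ (k * w + b, c) = (if b = c mod w then
      (if r mod w = c mod w then A $$ (r div w, k) * B $$ (k, c div w) else 0) else 0)"
      using rc kb by (simp add: tensor_id_index[OF A] tensor_id_index[OF B])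
  qed
  also have "\<dots> = (\<Sum>k<d. if r mod w = c mod w then A $$ (r div w, k) * B $$ (k, c div w) else 0)"
    using rc' by simp
  also have "\<dots> = tensor_id w (A * B) $$ (r, c)"
    using rc rc' A B by (simp add: tensor_id_index[OF AB] scalar_prod_def atLeast0LessThan)
  finally show "tensor_id w (A * B) $$ (r, c) = (tensor_id w A * tensor_id w B) $$ (r, c)" by simp
qed (use A B in \<open>auto simp: tensor_id_def\<close>)

lemma tensor_id_one: "0 < w \<Longrightarrow> tensor_id w (1\<^sub>m d) = 1\<^sub>m (d * w)"
proof (rule eq_matI)
  fix r c assume w: "0 < w" and "r < dim_row (1\<^sub>m (d * w) :: complex mat)" "c < dim_col (1\<^sub>m (d * w) :: complex mat)"
  then have rc: "r < d * w" "c < d * w" "r div w < d" "c div w < d" by (auto simp: less_mult_imp_div_less)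
  have "r = c \<longleftrightarrow> r div w = c div w \<and> r mod w = c mod w" by (metis div_mult_mod_eq)
  then show "tensor_id w (1\<^sub>m d) $$ (r, c) = 1\<^sub>m (d * w) $$ (r, c)"
    using rc by (auto simp: tensor_id_def)
qed (auto simp: tensor_id_def)

lemma unitary_tensor_id:
  assumes U: "unitary d U" and w: "0 < w" shows "unitary (d * w) (tensor_id w U)"
proof -
  note Uc = unitary_carrier[OF U]
  have adj: "mat_adjoint (tensor_id w U) = tensor_id w (mat_adjoint U)"
  proof (rule eq_matI)
    fix r c assume "r < dim_row (tensor_id w (mat_adjoint U))" "c < dim_col (tensor_id w (mat_adjoint U))"
    then have rc: "r < d * w" "c < d * w"
      using tensor_id_carrier[OF mat_adjoint_carrier[OF Uc], of w] by auto
    then have "r div w < d" "c div w < d" by (auto simp: less_mult_imp_div_less)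
    then show "mat_adjoint (tensor_id w U) $$ (r, c) = tensor_id w (mat_adjoint U) $$ (r, c)"
      using rc by (simp add: mat_adjoint_index[OF tensor_id_carrier[OF Uc]] mat_adjoint_index[OF Uc]
          tensor_id_index[OF Uc] tensor_id_index[OF mat_adjoint_carrier[OF Uc]])
  qed (auto simp: tensor_id_def mat_adjoint_def)
  show ?thesis
    using U w Uc mat_adjoint_carrier[OF Uc]
    by (simp add: unitary_def adj tensor_id_carrier tensor_id_one flip: tensor_id_mult)
qed

lemma query_op_tensor_id:
  assumes "0 < W" "0 < w"
  shows "query_op N (W * w) x = tensor_id w (query_op N W x)"
proof (rule eq_matI)
  fix r c assume "r < dim_row (tensor_id w (query_op N W x))" "c < dim_col (tensor_id w (query_op N W x))"
  then have rc: "r < N * 2 * W * w" "c < N * 2 * W * w" by (auto simp: tensor_id_def query_op_def)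
  then have rc': "r div w < N * 2 * W" "c div w < N * 2 * W" by (auto simp: less_mult_imp_div_less)
  define q where "q = c div w"
  define t where "t = (q div W div 2 * 2 + (q div W mod 2 + of_bool (x (q div W div 2))) mod 2) * W + q mod W"
  have c: "c div (W * w) = q div W" "c mod (W * w) = q mod W * w + c mod w"
    using div_mult2_eq[of c w W] mod_mult2_eq[of c w W] by (simp_all add: q_def mult.commute)
  have "(r = (q div W div 2 * 2 + (q div W mod 2 + of_bool (x (q div W div 2))) mod 2) * (W * w) +
      (q mod W * w + c mod w)) \<longleftrightarrow> r = t * w + c mod w"
    by (simp add: t_def algebra_simps)
  also have "\<dots> \<longleftrightarrow> r mod w = c mod w \<and> r div w = t"
  proof
    show "r mod w = c mod w \<and> r div w = t \<Longrightarrow> r = t * w + c mod w" by (metis div_mult_mod_eq)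
  qed (use assms in simp)
  finally show "query_op N (W * w) x $$ (r, c) = tensor_id w (query_op N W x) $$ (r, c)"
    using rc rc' by (auto simp: query_op_def tensor_id_def Let_def c q_def[symmetric] t_def[symmetric] mult.assoc)
qed (auto simp: query_op_def tensor_id_def)

text \<open>\<open>E\<close> can run beside a register of dimension \<open>w\<close> that it leaves
  alone, with the same number of queries; that register will hold the labels of the
  algorithm.\<close>

lemma realizable_tensor_id:
  assumes E: "valid_circuit N E" and w: "0 < w"
  shows "realizable N (work_dim E * w) (queries E)
    (\<lambda>x. tensor_id w (circuit_mat N (work_dim E) (first_op E) (later_ops E) x))"
proof -
  define d where "d = N * 2 * work_dim E"
  have W: "0 < work_dim E" and U: "\<forall>U\<in>insert (first_op E) (set (later_ops E)). unitary d U"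
    using E by (auto simp: valid_circuit_def d_def)
  have Q: "query_op N (work_dim E) x \<in> carrier_mat d d" for x by (simp add: d_def query_op_carrier)
  have "tensor_id w (circuit_mat N (work_dim E) F L x) =
      circuit_mat N (work_dim E * w) (tensor_id w F) (map (tensor_id w) L) x"
    if "F \<in> carrier_mat d d" "\<forall>U\<in>set L. U \<in> carrier_mat d d" for F L x
    using that
  proof (induction L arbitrary: F)
    case (Cons U L)
    have "U * (query_op N (work_dim E) x * F) \<in> carrier_mat d d"
      using Cons.prems Q[of x] by (auto intro!: mult_carrier_mat)
    moreover have "tensor_id w (U * (query_op N (work_dim E) x * F)) =
        tensor_id w U * (query_op N (work_dim E * w) x * tensor_id w F)"
      using Cons.prems Q[of x] w W by (simp add: query_op_tensor_id tensor_id_mult[of _ d])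
    ultimately show ?case using Cons.IH[of "U * (query_op N (work_dim E) x * F)"] Cons.prems
      by (simp add: circuit_mat_def)
  qed (simp add: circuit_mat_def)
  then have "tensor_id w (circuit_mat N (work_dim E) (first_op E) (later_ops E) x) =
      circuit_mat N (work_dim E * w) (tensor_id w (first_op E)) (map (tensor_id w) (later_ops E)) x" for x
    using U unitary_carrier by blast
  moreover have "\<forall>U\<in>insert (tensor_id w (first_op E)) (set (map (tensor_id w) (later_ops E))).
      unitary (N * 2 * (work_dim E * w)) U"
    using unitary_tensor_id[of d _ w] U w by (auto simp: d_def mult.assoc)
  ultimately show ?thesis
    unfolding realizable_def queries_def
    by (intro exI[of _ "tensor_id w (first_op E)"] exI[of _ "map (tensor_id w) (later_ops E)"]) auto
qed

section \<open>From adversary solutions to query algorithms\<close>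

definition embed_state :: "nat \<Rightarrow> 'p set \<Rightarrow> ('p \<Rightarrow> nat) \<Rightarrow> ('p \<Rightarrow> real) \<Rightarrow> complex vec" where
  "embed_state D P \<iota> \<phi> = vec D (\<lambda>r. \<Sum>p\<in>P. of_bool (\<iota> p = r) * complex_of_real (\<phi> p))"

lemma embed_state_carrier [simp]: "embed_state D P \<iota> \<phi> \<in> carrier_vec D"
  by (simp add: embed_state_def)

lemma embed_state_index: "r < D \<Longrightarrow> embed_state D P \<iota> \<phi> $ r = (\<Sum>p\<in>P. of_bool (\<iota> p = r) * complex_of_real (\<phi> p))"
  by (simp add: embed_state_def)

lemma embed_state_add: "embed_state D P \<iota> (\<lambda>p. \<phi> p + \<psi> p) = embed_state D P \<iota> \<phi> + embed_state D P \<iota> \<psi>"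
  by (intro eq_vecI) (auto simp: embed_state_def sum.distrib algebra_simps)

lemma embed_state_cong: "(\<And>p. p \<in> P \<Longrightarrow> \<phi> p = \<psi> p) \<Longrightarrow> embed_state D P \<iota> \<phi> = embed_state D P \<iota> \<psi>"
  by (intro eq_vecI) (auto simp: embed_state_def intro!: sum.cong)

lemma mult_embed_index:
  assumes A: "A \<in> carrier_mat D D" and "r < D" and "finite P" "\<iota> ` P \<subseteq> {..<D}"
  shows "(A *\<^sub>v embed_state D P \<iota> \<phi>) $ r = (\<Sum>p\<in>P. complex_of_real (\<phi> p) * A $$ (r, \<iota> p))"
proof -
  have "(A *\<^sub>v embed_state D P \<iota> \<phi>) $ r =
      (\<Sum>c<D. \<Sum>p\<in>P. if c = \<iota> p then complex_of_real (\<phi> p) * A $$ (r, c) else 0)"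
    unfolding mult_mat_vec_index_sum[OF A embed_state_carrier \<open>r < D\<close>]
    by (intro sum.cong refl) (auto simp: embed_state_index sum_distrib_left intro!: sum.cong)
  also have "\<dots> = (\<Sum>p\<in>P. \<Sum>c<D. if c = \<iota> p then complex_of_real (\<phi> p) * A $$ (r, c) else 0)"
    by (rule sum.swap)
  also have "\<dots> = (\<Sum>p\<in>P. complex_of_real (\<phi> p) * A $$ (r, \<iota> p))"
    using assms(4) by (intro sum.cong refl) auto
  finally show ?thesis .
qed

lemma cdot_embed:
  assumes "finite P" "inj_on \<iota> P" "\<iota> ` P \<subseteq> {..<D}"
  shows "cdot D (embed_state D P \<iota> \<phi>) (embed_state D P \<iota> \<psi>) = complex_of_real (\<Sum>p\<in>P. \<phi> p * \<psi> p)"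
proof -
  have at: "embed_state D P \<iota> \<psi> $ \<iota> q = complex_of_real (\<psi> q)" if q: "q \<in> P" for q
  proof -
    have "embed_state D P \<iota> \<psi> $ \<iota> q = (\<Sum>p\<in>P. of_bool (\<iota> p = \<iota> q) * complex_of_real (\<psi> p))"
      by (rule embed_state_index) (use q assms(3) in auto)
    also have "\<dots> = (\<Sum>p\<in>P. if p = q then complex_of_real (\<psi> p) else 0)"
      by (intro sum.cong refl) (use q assms(2) in \<open>auto simp: inj_on_def\<close>)
    finally show ?thesis using q assms(1) by simp
  qed
  have "cdot D (embed_state D P \<iota> \<phi>) (embed_state D P \<iota> \<psi>) =
      (\<Sum>r<D. \<Sum>p\<in>P. if r = \<iota> p then complex_of_real (\<phi> p) * embed_state D P \<iota> \<psi> $ r else 0)"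
    unfolding cdot_def
  proof (intro sum.cong[OF refl])
    fix r assume "r \<in> {..<D}"
    then have rD: "r < D" by simp
    have cnj: "cnj (embed_state D P \<iota> \<phi> $ r) = (\<Sum>p\<in>P. of_bool (\<iota> p = r) * complex_of_real (\<phi> p))"
      unfolding embed_state_index[OF rD] cnj_sum by (intro sum.cong) auto
    show "cnj (embed_state D P \<iota> \<phi> $ r) * embed_state D P \<iota> \<psi> $ r =
        (\<Sum>p\<in>P. if r = \<iota> p then complex_of_real (\<phi> p) * embed_state D P \<iota> \<psi> $ r else 0)"
      unfolding cnj sum_distrib_right by (intro sum.cong) auto
  qed
  also have "\<dots> = (\<Sum>p\<in>P. \<Sum>r<D. if r = \<iota> p then complex_of_real (\<phi> p) * embed_state D P \<iota> \<psi> $ r else 0)"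
    by (rule sum.swap)
  also have "\<dots> = (\<Sum>p\<in>P. complex_of_real (\<phi> p) * embed_state D P \<iota> \<psi> $ \<iota> p)"
    using assms(3) by (intro sum.cong refl) auto
  also have "\<dots> = complex_of_real (\<Sum>p\<in>P. \<phi> p * \<psi> p)" by (simp add: at)
  finally show ?thesis .
qed

text \<open>Only the columns of \<open>A\<close> at the positions \<open>\<iota> p\<close> are
  prescribed, because a coherent evaluation says nothing about unclean registers. As
  \<open>\<tau>\<close> is an involution, moving the basis states by \<open>\<tau>\<close> means
  reading the amplitudes through \<open>\<tau>\<close>.\<close>

lemma mult_embed_permute:
  assumes A: "A \<in> carrier_mat D D" and P: "finite P" "\<iota> ` P \<subseteq> {..<D}"
    and \<tau>: "\<And>p. p \<in> P \<Longrightarrow> \<tau> p \<in> P" "\<And>p. p \<in> P \<Longrightarrow> \<tau> (\<tau> p) = p"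
    and col: "\<And>p r. p \<in> P \<Longrightarrow> r < D \<Longrightarrow> A $$ (r, \<iota> p) = of_bool (r = \<iota> (\<tau> p))"
  shows "A *\<^sub>v embed_state D P \<iota> \<phi> = embed_state D P \<iota> (\<lambda>p. \<phi> (\<tau> p))"
proof (rule eq_vecI)
  fix r assume "r < dim_vec (embed_state D P \<iota> (\<lambda>p. \<phi> (\<tau> p)))"
  then have r: "r < D" by (simp add: embed_state_def)
  have "(A *\<^sub>v embed_state D P \<iota> \<phi>) $ r = (\<Sum>p\<in>P. complex_of_real (\<phi> p) * of_bool (r = \<iota> (\<tau> p)))"
    unfolding mult_embed_index[OF A r P] using col r by (intro sum.cong) auto
  also have "\<dots> = (\<Sum>p\<in>P. complex_of_real (\<phi> (\<tau> p)) * of_bool (r = \<iota> p))"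
    by (rule sum.reindex_bij_witness[of _ \<tau> \<tau>]) (use \<tau> in auto)
  also have "\<dots> = embed_state D P \<iota> (\<lambda>p. \<phi> (\<tau> p)) $ r"
    unfolding embed_state_index[OF r] by (intro sum.cong) auto
  finally show "(A *\<^sub>v embed_state D P \<iota> \<phi>) $ r = embed_state D P \<iota> (\<lambda>p. \<phi> (\<tau> p)) $ r" .
qed (use A in \<open>auto simp: embed_state_def\<close>)

section \<open>The ideal states and their Gram matrices\<close>

text \<open>A basis state \<open>(k, z, s)\<close> has query index \<open>k\<close> and target bit \<open>z\<close>; \<open>s\<close> is the initial label
  \<open>Inl None\<close>, an output label \<open>Inl (Some y)\<close>, or a label of the catalyst.\<close>

definition registers ::
  "nat \<Rightarrow> 'i set \<Rightarrow> ('i \<Rightarrow> 'g) \<Rightarrow> 'l set \<Rightarrow> (nat \<times> bool \<times> ('g option + bool \<times> 'l)) set" where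
  "registers M X F L = {..<M} \<times> UNIV \<times> (insert None (Some ` F ` X) <+> (UNIV \<times> L))"

text \<open>Inequality of booleans is exclusive or: this models one coherent evaluation of the bits
  \<open>b\<close> into the target bit.\<close>

definition flip :: "(nat \<Rightarrow> bool) \<Rightarrow> nat \<times> bool \<times> 's \<Rightarrow> nat \<times> bool \<times> 's" where
  "flip b = (\<lambda>(k, z, s). (k, z \<noteq> b k, s))"

definition phase :: "bool \<Rightarrow> real" where
  "phase z = (if z then -1 else 1)"

text \<open>The two values of the target bit have opposite amplitudes, so a query multiplies by -1
  at the positions where \<open>b\<close> is true. The half with \<open>h\<close> acquires this
  sign; the other half carries it beforehand and loses it. Polarisation, (u + v)(u' + v') - (u -
  v)(u' - v') = 2(uv' + vu'), turns the change of inner products into the adversary condition, and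
  the factor 1/4 makes the total change 0 or 1.\<close>

definition catalyst ::
  "((nat \<Rightarrow> bool) \<Rightarrow> 'l \<Rightarrow> nat \<Rightarrow> real) \<Rightarrow> ((nat \<Rightarrow> bool) \<Rightarrow> 'l \<Rightarrow> nat \<Rightarrow> real) \<Rightarrow>
    (nat \<Rightarrow> bool) \<Rightarrow> nat \<times> bool \<times> ('g option + bool \<times> 'l) \<Rightarrow> real" where
  "catalyst u v b = (\<lambda>(k, z, s). case s of Inl _ \<Rightarrow> 0
     | Inr (h, l) \<Rightarrow> if h then phase z * (u b l k + v b l k) / 4
                   else phase (z \<noteq> b k) * (u b l k - v b l k) / 4)"

text \<open>The target bit of the public part is in the state \<open>(|0> + |1>) / sqrt 2\<close>, which queries fix.\<close>

definition public_part :: "real \<Rightarrow> 'g \<Rightarrow> nat \<times> bool \<times> ('g option + 'c) \<Rightarrow> real" where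
  "public_part p y = (\<lambda>(k, z, s). case s of
       Inl None \<Rightarrow> of_bool (k = 0) * sqrt ((1 - p) / 2)
     | Inl (Some y') \<Rightarrow> of_bool (k = 0 \<and> y' = y) * sqrt (p / 2)
     | Inr _ \<Rightarrow> 0)"

text \<open>\<open>t / K\<close> is the squared weight already moved to the output label. The
  catalyst makes the norm exceed 1 in general, which is harmless because only Gram matrices are
  compared.\<close>

definition ideal_state where
  "ideal_state K F u v t b p = public_part (real t / real K) (F b) p + catalyst u v b p / sqrt (real K)"

lemma sum_registers:
  fixes g :: "_ \<Rightarrow> real"
  assumes "finite X" "finite L"
  shows "sum g (registers M X F L) =
    (\<Sum>k<M. \<Sum>z\<in>UNIV. g (k, z, Inl None) + (\<Sum>y\<in>F ` X. g (k, z, Inl (Some y)))) +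
    (\<Sum>l\<in>L. \<Sum>k<M. \<Sum>z\<in>UNIV. \<Sum>h\<in>UNIV. g (k, z, Inr (h, l)))"
proof -
  have "sum g (registers M X F L) =
    (\<Sum>k<M. \<Sum>z\<in>UNIV. (g (k, z, Inl None) + (\<Sum>y\<in>F ` X. g (k, z, Inl (Some y)))) +
      (\<Sum>h\<in>UNIV. \<Sum>l\<in>L. g (k, z, Inr (h, l))))"
    using assms by (simp add: registers_def sum_Sigma_nested sum.Plus sum.reindex)
  also have "\<dots> = (\<Sum>k<M. \<Sum>z\<in>UNIV. g (k, z, Inl None) + (\<Sum>y\<in>F ` X. g (k, z, Inl (Some y)))) +
    (\<Sum>k<M. \<Sum>z\<in>UNIV. \<Sum>h\<in>UNIV. \<Sum>l\<in>L. g (k, z, Inr (h, l)))"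
    by (simp only: sum.distrib)
  also have "(\<Sum>k<M. \<Sum>z\<in>UNIV. \<Sum>h\<in>UNIV. \<Sum>l\<in>L. g (k, z, Inr (h, l))) =
      (\<Sum>l\<in>L. \<Sum>k<M. \<Sum>z\<in>UNIV. \<Sum>h\<in>UNIV. g (k, z, Inr (h, l)))"
    by (simp only: sum.swap[of _ L])
  finally show ?thesis .
qed

text \<open>With \<open>\<tau>\<close> and \<open>\<sigma>\<close> either identities or flips, one
  computation covers the states before and after a query. Both maps change only the target bit, on
  which the public part does not depend, and public part and catalyst have disjoint supports, so
  there are no cross terms.\<close>

lemma gram_public_catalyst:
  assumes fin: "finite X" "finite L" and M: "0 < M" and b: "b \<in> X" and p: "0 \<le> p" "p \<le> 1"
    and \<tau>: "\<And>k z s. \<tau> (k, z, s) = (k, \<tau>' k z, s)" "\<And>k z s. \<sigma> (k, z, s) = (k, \<sigma>' k z, s)"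
  shows "(\<Sum>q\<in>registers M X F L. (public_part p (F b) (\<tau> q) + catalyst u v b (\<tau> q) / sqrt K) *
      (public_part p (F c) (\<sigma> q) + catalyst u v c (\<sigma> q) / sqrt K)) =
    1 - p * of_bool (F b \<noteq> F c) + (\<Sum>q\<in>registers M X F L. catalyst u v b (\<tau> q) * catalyst u v c (\<sigma> q)) / \<bar>K\<bar>"
proof -
  have pub: "(\<Sum>k<M. \<Sum>z\<in>(UNIV :: bool set). of_bool (k = 0) * ((1 - p) / 2) +
      (\<Sum>y\<in>F ` X. of_bool (k = 0) * (p / 2) * of_bool (y = F b \<and> y = F c))) = 1 - p * of_bool (F b \<noteq> F c)"
  proof -
    have outputs: "(\<Sum>y\<in>F ` X. of_bool (k = (0::nat)) * (p / 2) * of_bool (y = F b \<and> y = F c)) =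
        of_bool (k = 0) * (p / 2 * of_bool (F b = F c))" for k
    proof -
      have "(\<Sum>y\<in>F ` X. of_bool (k = (0::nat)) * (p / 2) * of_bool (y = F b \<and> y = F c)) =
        (\<Sum>y\<in>F ` X. if y = F b then of_bool (k = 0) * (p / 2 * of_bool (F b = F c)) else 0)"
        by (intro sum.cong) auto
      then show ?thesis using fin b by simp
    qed
    have "(\<Sum>k<M. \<Sum>z\<in>(UNIV :: bool set). of_bool (k = 0) * ((1 - p) / 2) +
      (\<Sum>y\<in>F ` X. of_bool (k = 0) * (p / 2) * of_bool (y = F b \<and> y = F c))) =
      (\<Sum>k<M. if k = 0 then 1 - p * of_bool (F b \<noteq> F c) else 0)"
      unfolding outputs by (intro sum.cong) (auto simp: UNIV_bool field_simps)
    then show ?thesis using M by simp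
  qed
  have "(\<Sum>q\<in>registers M X F L. (public_part p (F b) (\<tau> q) + catalyst u v b (\<tau> q) / sqrt K) *
      (public_part p (F c) (\<sigma> q) + catalyst u v c (\<sigma> q) / sqrt K)) =
     (\<Sum>q\<in>registers M X F L. public_part p (F b) (\<tau> q) * public_part p (F c) (\<sigma> q)) +
     (\<Sum>q\<in>registers M X F L. catalyst u v b (\<tau> q) * catalyst u v c (\<sigma> q)) / \<bar>K\<bar>"
  proof -
    have "(public_part p (F b) (\<tau> q) + catalyst u v b (\<tau> q) / sqrt K) *
      (public_part p (F c) (\<sigma> q) + catalyst u v c (\<sigma> q) / sqrt K) =
      public_part p (F b) (\<tau> q) * public_part p (F c) (\<sigma> q) + catalyst u v b (\<tau> q) * catalyst u v c (\<sigma> q) / \<bar>K\<bar>" for q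
      by (cases q) (auto simp: \<tau> public_part_def catalyst_def split: sum.split option.split)
    then show ?thesis by (simp add: sum.distrib sum_divide_distrib)
  qed
  also have "(\<Sum>q\<in>registers M X F L. public_part p (F b) (\<tau> q) * public_part p (F c) (\<sigma> q)) =
     (\<Sum>k<M. \<Sum>z\<in>(UNIV :: bool set). of_bool (k = 0) * ((1 - p) / 2) +
      (\<Sum>y\<in>F ` X. of_bool (k = 0) * (p / 2) * of_bool (y = F b \<and> y = F c)))"
  proof -
    have half: "sqrt (r / 2) * (sqrt (r / 2) * 2) = r" if "0 \<le> r" for r :: real
    proof -
      have "sqrt (r / 2) * (sqrt (r / 2) * 2) = (sqrt (r / 2))\<^sup>2 * 2"
        by (simp only: power2_eq_square mult.assoc)
      then show ?thesis using that by simp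
    qed
    have "(\<Sum>y\<in>F ` X. public_part p (F b) (\<tau> (k, z, Inl (Some y))) * public_part p (F c) (\<sigma> (k, z, Inl (Some y)))) =
        (\<Sum>y\<in>F ` X. of_bool (k = 0) * (p / 2) * of_bool (y = F b \<and> y = F c))" for k z
      by (intro sum.cong) (use p half in \<open>auto simp: \<tau> public_part_def\<close>)
    moreover have "public_part p (F b) (\<tau> (k, z, Inl None)) * public_part p (F c) (\<sigma> (k, z, Inl None)) =
        of_bool (k = 0) * ((1 - p) / 2)" for k z
      using p half[of "1 - p"] by (simp add: \<tau> public_part_def)
    moreover have "public_part p (F b) (\<tau> (k, z, Inr s)) * public_part p (F c) (\<sigma> (k, z, Inr s)) = 0" for k z s
      by (simp add: \<tau> public_part_def)
    ultimately show ?thesis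
      unfolding sum_registers[OF fin] by (simp only: sum.neutral_const add_0_right)
  qed
  finally show ?thesis using pub by simp
qed

text \<open>Where \<open>b\<close> and \<open>b'\<close> agree a query changes no product; where
  they differ it reverses the sign of the products in both halves. What remains is the mean of the
  adversary sums for the pair in its two orders, and these are equal.\<close>

lemma catalyst_gram_diff:
  fixes F :: "(nat \<Rightarrow> bool) \<Rightarrow> 'g" and L :: "'l set"
  assumes sol: "adv_solution M X F c L u v" and X: "finite X" "b \<in> X" "b' \<in> X"
  shows "(\<Sum>q\<in>registers M X F L. catalyst u v b q * catalyst u v b' q) -
     (\<Sum>q\<in>registers M X F L. catalyst u v b (flip b q) * catalyst u v b' (flip b' q)) =
     of_bool (F b \<noteq> F b')"
proof -
  have L: "finite L" using sol by (simp add: adv_solution_def)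
  define \<delta> :: "nat \<times> bool \<times> ('g option + bool \<times> 'l) \<Rightarrow> real" where
    "\<delta> q = catalyst u v b q * catalyst u v b' q - catalyst u v b (flip b q) * catalyst u v b' (flip b' q)" for q
  have inner: "(\<Sum>z\<in>UNIV. \<Sum>h\<in>UNIV. \<delta> (k, z, Inr (h, l))) =
      of_bool (b k \<noteq> b' k) * u b l k * v b' l k / 2 + of_bool (b' k \<noteq> b k) * u b' l k * v b l k / 2" for k l
    by (cases "b k"; cases "b' k")
      (simp_all add: \<delta>_def UNIV_bool catalyst_def flip_def phase_def field_simps)
  have zero: "\<delta> (k, z, Inl s) = 0" for k z s by (simp add: \<delta>_def catalyst_def flip_def)
  have "(\<Sum>q\<in>registers M X F L. catalyst u v b q * catalyst u v b' q) -
     (\<Sum>q\<in>registers M X F L. catalyst u v b (flip b q) * catalyst u v b' (flip b' q)) =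
     (\<Sum>q\<in>registers M X F L. \<delta> q)"
    by (simp add: \<delta>_def sum_subtractf)
  also have "\<dots> = (\<Sum>l\<in>L. \<Sum>k<M. of_bool (b k \<noteq> b' k) * u b l k * v b' l k / 2 +
        of_bool (b' k \<noteq> b k) * u b' l k * v b l k / 2)"
    unfolding sum_registers[OF X(1) L] inner by (simp add: zero)
  also have "\<dots> = (\<Sum>l\<in>L. diff_dot M b b' (u b l) (v b' l)) / 2 + (\<Sum>l\<in>L. diff_dot M b' b (u b' l) (v b l)) / 2"
    by (simp add: diff_dot_def sum.distrib sum_divide_distrib)
  also have "\<dots> = of_bool (F b \<noteq> F b')"
    using sol X by (auto simp: adv_solution_def)
  finally show ?thesis .
qed

text \<open>In the sum over \<open>h\<close> the mixed terms of (u + v)^2 and (u - v)^2 cancel,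
  leaving (u^2 + v^2) / 4 for each label and position.\<close>

lemma catalyst_norm:
  assumes sol: "adv_solution M X F c L u v" and X: "finite X" "b \<in> X"
  shows "(\<Sum>q\<in>registers M X F L. (catalyst u v b q)\<^sup>2) \<le> c / 2"
proof -
  have L: "finite L" using sol by (simp add: adv_solution_def)
  have "(\<Sum>q\<in>registers M X F L. (catalyst u v b q)\<^sup>2) =
     (\<Sum>l\<in>L. \<Sum>k<M. (u b l k)\<^sup>2 / 4 + (v b l k)\<^sup>2 / 4)"
    unfolding sum_registers[OF X(1) L]
    by (auto simp: catalyst_def UNIV_bool phase_def field_simps power2_eq_square intro!: sum.cong)
  also have "\<dots> = (\<Sum>l\<in>L. sq_norm M (u b l)) / 4 + (\<Sum>l\<in>L. sq_norm M (v b l)) / 4"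
    by (simp add: sq_norm_def sum.distrib sum_divide_distrib)
  also have "\<dots> \<le> c / 2" using sol X(2) by (auto simp: adv_solution_def)
  finally show ?thesis .
qed

text \<open>For a pair with different values the query takes \<open>1 / K\<close> off the catalyst
  term, and this is the drop of the public term when its weight grows from \<open>t / K\<close> to
  \<open>Suc t / K\<close>.\<close>

lemma ideal_state_gram:
  assumes sol: "adv_solution M X F c L u v" and X: "finite X" "b \<in> X" "b' \<in> X"
    and M: "0 < M" and t: "t < K"
  shows "(\<Sum>q\<in>registers M X F L. ideal_state K F u v t b (flip b q) * ideal_state K F u v t b' (flip b' q)) =
    (\<Sum>q\<in>registers M X F L. ideal_state K F u v (Suc t) b q * ideal_state K F u v (Suc t) b' q)"
proof -
  have L: "finite L" using sol by (simp add: adv_solution_def)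
  have "(\<Sum>q\<in>registers M X F L. ideal_state K F u v t b (flip b q) * ideal_state K F u v t b' (flip b' q)) =
     1 - t / K * of_bool (F b \<noteq> F b') +
     (\<Sum>q\<in>registers M X F L. catalyst u v b (flip b q) * catalyst u v b' (flip b' q)) / \<bar>real K\<bar>"
    unfolding ideal_state_def 
    by (rule gram_public_catalyst[OF X(1) L M X(2), where \<tau>' = "\<lambda>k z. z \<noteq> b k" and \<sigma>' = "\<lambda>k z. z \<noteq> b' k"])
      (use t in \<open>auto simp: flip_def\<close>)
  also have "\<dots> = 1 - Suc t / K * of_bool (F b \<noteq> F b') +
     (\<Sum>q\<in>registers M X F L. catalyst u v b q * catalyst u v b' q) / \<bar>real K\<bar>"
    using catalyst_gram_diff[OF sol X] t by (simp add: field_simps)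
  also have "\<dots> = (\<Sum>q\<in>registers M X F L. ideal_state K F u v (Suc t) b q * ideal_state K F u v (Suc t) b' q)"
    unfolding ideal_state_def
    by (rule gram_public_catalyst[OF X(1) L M X(2), where \<tau>' = "\<lambda>k z. z" and \<sigma>' = "\<lambda>k z. z", symmetric])
      (use t in auto)
  finally show ?thesis .
qed

section \<open>Evolution along the ideal states and the resulting algorithm\<close>

lemma flip_registers: "q \<in> registers M X F L \<Longrightarrow> flip b q \<in> registers M X F L"
  by (auto simp: registers_def flip_def)

lemma flip_flip: "flip b (flip b q) = q"
  by (cases q) (auto simp: flip_def)

text \<open>The operators inserted between uses of \<open>R\<close> are obtained from Gram matrices
  over all of \<open>X\<close>, so they depend neither on \<open>x\<close> nor on \<open>b\<close>.
  The input enters only through \<open>R x\<close>, and the same \<open>G\<close> serves every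
  \<open>x\<close> whose \<open>R x\<close> evaluates some \<open>b\<close> in
  \<open>X\<close>.\<close>

lemma realizable_ideal_evolution:
  assumes W: "0 < W" and R: "realizable N W T R"
    and sol: "adv_solution M X F c L u v" and X: "finite X" and M: "0 < M"
    and \<iota>: "inj_on \<iota> (registers M X F L)" "\<iota> ` registers M X F L \<subseteq> {..<N * 2 * W}"
    and "t \<le> K"
  defines "st \<equiv> \<lambda>s b. embed_state (N * 2 * W) (registers M X F L) \<iota> (ideal_state K F u v s b)"
  shows "\<exists>G. realizable N W (t * T) G \<and> (\<forall>x b. b \<in> X \<longrightarrow>
     (\<forall>\<phi>. R x *\<^sub>v embed_state (N * 2 * W) (registers M X F L) \<iota> \<phi> =
           embed_state (N * 2 * W) (registers M X F L) \<iota> (\<lambda>p. \<phi> (flip b p))) \<longrightarrow>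
     G x *\<^sub>v st 0 b = st t b)"
  using \<open>t \<le> K\<close>
proof (induction t)
  case 0
  have "1\<^sub>m (N * 2 * W) *\<^sub>v st 0 b = st 0 b" for b by (simp add: st_def)
  then show ?case using realizable_const[OF unitary_one] by (intro exI[of _ "\<lambda>_. 1\<^sub>m (N * 2 * W)"]) simp
next
  case (Suc t)
  let ?D = "N * 2 * W" and ?P = "registers M X F L"
  have P: "finite ?P" using sol X by (simp add: registers_def adv_solution_def)
  obtain G where G: "realizable N W (t * T) G" and
    step: "\<And>x b. b \<in> X \<Longrightarrow>
      (\<And>\<phi>. R x *\<^sub>v embed_state ?D ?P \<iota> \<phi> = embed_state ?D ?P \<iota> (\<lambda>p. \<phi> (flip b p))) \<Longrightarrow>
      G x *\<^sub>v st 0 b = st t b"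
    using Suc by auto
  obtain U where U: "unitary ?D U" and
    Ust: "\<And>b. b \<in> X \<Longrightarrow> U *\<^sub>v embed_state ?D ?P \<iota> (\<lambda>p. ideal_state K F u v t b (flip b p)) = st (Suc t) b"
  proof -
    have "\<exists>U. unitary ?D U \<and> (\<forall>b\<in>X. U *\<^sub>v embed_state ?D ?P \<iota> (\<lambda>p. ideal_state K F u v t b (flip b p)) = st (Suc t) b)"
    proof (rule unitary_of_gram[OF X])
      fix b b' assume "b \<in> X" "b' \<in> X"
      then show "cdot ?D (embed_state ?D ?P \<iota> (\<lambda>p. ideal_state K F u v t b (flip b p)))
          (embed_state ?D ?P \<iota> (\<lambda>p. ideal_state K F u v t b' (flip b' p))) = cdot ?D (st (Suc t) b) (st (Suc t) b')"
        unfolding st_def cdot_embed[OF P \<iota>]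
        using ideal_state_gram[OF sol X _ _ M, of b b' t K] Suc.prems by simp
    qed (simp_all add: st_def)
    then show ?thesis using that by blast
  qed
  have real: "realizable N W (t * T + T + 0) (\<lambda>x. U * (R x * G x))"
    by (rule realizable_mult[OF W realizable_mult[OF W G R] realizable_const[OF U]])
  have "(U * (R x * G x)) *\<^sub>v st 0 b = st (Suc t) b"
    if b: "b \<in> X" and act: "\<And>\<phi>. R x *\<^sub>v embed_state ?D ?P \<iota> \<phi> = embed_state ?D ?P \<iota> (\<lambda>p. \<phi> (flip b p))" for x b
  proof -
    have c: "U \<in> carrier_mat ?D ?D" "R x \<in> carrier_mat ?D ?D" "G x \<in> carrier_mat ?D ?D" "st 0 b \<in> carrier_vec ?D"
      using U realizable_unitary[OF W R] realizable_unitary[OF W G] by (auto intro: unitary_carrier simp: st_def)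
    have "(U * (R x * G x)) *\<^sub>v st 0 b = U *\<^sub>v (R x *\<^sub>v (G x *\<^sub>v st 0 b))"
      using c by (simp add: assoc_mult_mat_vec[of _ ?D ?D _ ?D])
    then show ?thesis using step[OF b act] act Ust[OF b] by (simp add: st_def)
  qed
  then show ?case using real by (intro exI[of _ "\<lambda>x. U * (R x * G x)"]) (simp add: add.commute)
qed

text \<open>\<open>a\<close> is the true initial state and \<open>e\<close> the omitted catalyst. On
  the wrong outputs \<open>B\<close> the ideal final state is just \<open>e\<close>, so the true one
  equals e - G e there; its squared norm is at most twice that of \<open>e\<close> plus twice that
  of \<open>G *\<^sub>v e\<close>, and \<open>G\<close> preserves norms.\<close>

lemma perturbed_output_bound:
  assumes G: "unitary D G" and a: "a \<in> carrier_vec D" and e: "e \<in> carrier_vec D"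
    and B: "B \<subseteq> {..<D}" "\<And>r. r \<in> B \<Longrightarrow> (G *\<^sub>v (a + e)) $ r = e $ r"
    and norm: "cdot D e e = complex_of_real s"
  shows "(\<Sum>r\<in>B. (cmod ((G *\<^sub>v a) $ r))\<^sup>2) \<le> 4 * s"
proof -
  note Gc = unitary_carrier[OF G]
  have "(G *\<^sub>v a) $ r = e $ r - (G *\<^sub>v e) $ r" if r: "r \<in> B" for r
  proof -
    have "G *\<^sub>v (a + e) = G *\<^sub>v a + G *\<^sub>v e" by (rule mult_add_distrib_mat_vec[OF Gc a e])
    moreover have "r < dim_vec (G *\<^sub>v e)" using r B Gc by auto
    ultimately have "(G *\<^sub>v (a + e)) $ r = (G *\<^sub>v a) $ r + (G *\<^sub>v e) $ r" by (simp del: index_mult_mat_vec)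
    then show ?thesis using B(2)[OF r] by simp
  qed
  then have "(\<Sum>r\<in>B. (cmod ((G *\<^sub>v a) $ r))\<^sup>2) \<le> (\<Sum>r\<in>B. 2 * (cmod (e $ r))\<^sup>2 + 2 * (cmod ((G *\<^sub>v e) $ r))\<^sup>2)"
  proof (intro sum_mono)
    fix r assume "r \<in> B" "\<And>r. r \<in> B \<Longrightarrow> (G *\<^sub>v a) $ r = e $ r - (G *\<^sub>v e) $ r"
    then have "cmod ((G *\<^sub>v a) $ r) \<le> cmod (e $ r) + cmod ((G *\<^sub>v e) $ r)" by (simp add: norm_triangle_ineq4)
    then have "(cmod ((G *\<^sub>v a) $ r))\<^sup>2 \<le> (cmod (e $ r) + cmod ((G *\<^sub>v e) $ r))\<^sup>2" by (intro power_mono) auto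
    also have "\<dots> \<le> 2 * (cmod (e $ r))\<^sup>2 + 2 * (cmod ((G *\<^sub>v e) $ r))\<^sup>2"
      using zero_le_power2[of "cmod (e $ r) - cmod ((G *\<^sub>v e) $ r)"] unfolding power2_sum power2_diff by linarith
    finally show "(cmod ((G *\<^sub>v a) $ r))\<^sup>2 \<le> 2 * (cmod (e $ r))\<^sup>2 + 2 * (cmod ((G *\<^sub>v e) $ r))\<^sup>2" .
  qed
  also have "\<dots> \<le> (\<Sum>r<D. 2 * (cmod (e $ r))\<^sup>2 + 2 * (cmod ((G *\<^sub>v e) $ r))\<^sup>2)"
    using B by (intro sum_mono2) auto
  also have "\<dots> = 2 * (\<Sum>r<D. (cmod (e $ r))\<^sup>2) + 2 * (\<Sum>r<D. (cmod ((G *\<^sub>v e) $ r))\<^sup>2)"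
    by (simp only: sum.distrib sum_distrib_left)
  also have "(\<Sum>r<D. (cmod (e $ r))\<^sup>2) = s"
    using norm unfolding cdot_self by (simp only: of_real_eq_iff)
  also have "(\<Sum>r<D. (cmod ((G *\<^sub>v e) $ r))\<^sup>2) = s"
    using norm unitary_cdot[OF G e e] unfolding cdot_self by (simp only: of_real_eq_iff)
  finally show ?thesis by simp
qed

text \<open>\<open>E\<close> acts as the query to the bits \<open>b\<close>. The catalyst has
  squared norm at most \<open>c / 2 / K\<close> after scaling, so the error is at most 2c / K, and
  \<open>20 * c \<le> K\<close> makes this 0.1.\<close>

theorem adversary_algorithm:
  fixes F :: "(nat \<Rightarrow> bool) \<Rightarrow> 'g" and sel :: "'g \<Rightarrow> 'o"
  assumes E: "valid_circuit N E" and dim: "work_dim E = M * 2 * a" and X: "finite X"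
    and adv: "adv M X F c" and K: "20 * c \<le> real K" "0 < K"
  shows "\<exists>A :: 'o query_algorithm. valid_circuit N A \<and> queries A = K * queries E \<and>
    (\<forall>x. \<forall>b\<in>X. \<forall>C.
       (\<forall>k<M. \<forall>z<2. run N E x (ket N (work_dim E) 0 0 ((k * 2 + z) * a)) =
          ket N (work_dim E) 0 0 ((k * 2 + (z + of_bool (b k)) mod 2) * a)) \<longrightarrow>
       sel (F b) \<in> C \<longrightarrow> error_prob N A x C \<le> 0.1)"
proof -
  from adv obtain L :: "nat set" and u v where sol: "adv_solution M X F c L u v"
    unfolding adv_def by blast
  have N: "0 < N" and WE: "0 < work_dim E" using E by (auto simp: valid_circuit_def)
  then have M: "0 < M" and a: "0 < a" using dim by (auto intro: Nat.gr0I)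
  let ?P = "registers M X F L"
  let ?S = "insert None (Some ` F ` X) <+> (UNIV :: bool set) \<times> L"
  have "finite ?S" using X sol by (simp add: adv_solution_def)
  then obtain e where e: "bij_betw e ?S {0..<card ?S}" using ex_bij_betw_finite_nat by blast
  define w where "w = card ?S"
  have w: "0 < w" using \<open>finite ?S\<close> by (auto simp: w_def card_gt_0_iff)
  have e_less: "e s < w" if "s \<in> ?S" for s using bij_betwE[OF e] that by (auto simp: w_def)
  have e_inj: "s = s'" if "e s = e s'" "s \<in> ?S" "s' \<in> ?S" for s s'
    using e that by (auto simp: bij_betw_def inj_on_def)
  define W where "W = work_dim E * w"
  have W: "0 < W" using WE w by (simp add: W_def)
  define D where "D = N * 2 * W"
  define pos where "pos k z = (k * 2 + of_bool z) * a" for k :: nat and z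
  define \<iota> where "\<iota> = (\<lambda>(k, z, s). pos k z * w + e s)"
  have P: "finite ?P" using X sol by (simp add: registers_def adv_solution_def)
  have mem: "(k, z, s) \<in> ?P \<longleftrightarrow> k < M \<and> s \<in> ?S" for k z s by (auto simp: registers_def)
  have pos_less: "pos k z < work_dim E" if "k < M" for k z
  proof -
    have "k * 2 + of_bool z < M * 2" using that by (cases z) auto
    then show ?thesis using a by (simp add: pos_def dim)
  qed
  have div_mod: "\<iota> (k, z, s) div w = pos k z" "\<iota> (k, z, s) mod w = e s" if "s \<in> ?S" for k z s
    using e_less[OF that] by (simp_all add: \<iota>_def)
  have inj: "inj_on \<iota> ?P"
  proof (rule inj_onI)
    fix p q assume pq: "p \<in> ?P" "q \<in> ?P" "\<iota> p = \<iota> q"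
    obtain k z s k' z' s' where p: "p = (k, z, s)" and q: "q = (k', z', s')" by (metis prod.collapse)
    have s: "s \<in> ?S" "s' \<in> ?S" using pq mem unfolding p q by blast+
    have "pos k z = pos k' z'" "e s = e s'" using div_mod s pq(3) unfolding p q by metis+
    moreover from this have "k * 2 + of_bool z = k' * 2 + of_bool z'" using a by (simp add: pos_def)
    then have "k = k' \<and> z = z'" by (cases z; cases z') (simp_all, presburger+)
    ultimately show "p = q" using e_inj s p q by blast
  qed
  have range_less: "\<iota> p < W" if "p \<in> ?P" for p
  proof -
    obtain k z s where p: "p = (k, z, s)" by (metis prod.collapse)
    have "k < M" "s \<in> ?S" using that mem unfolding p by blast+
    then have "pos k z * w + e s < Suc (pos k z) * w" using e_less by simp
    also have "\<dots> \<le> work_dim E * w" using pos_less[OF \<open>k < M\<close>, of z] by (intro mult_right_mono) auto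
    finally show ?thesis by (simp add: p \<iota>_def W_def)
  qed
  have "W \<le> D" using N by (simp add: D_def)
  then have range: "\<iota> ` ?P \<subseteq> {..<N * 2 * W}"
    using range_less unfolding D_def[symmetric] by (meson image_subsetI lessThan_iff less_le_trans)

  define CE where "CE = circuit_mat N (work_dim E) (first_op E) (later_ops E)"
  define R where "R x = tensor_id w (CE x)" for x
  have R: "realizable N W (queries E) R"
    using realizable_tensor_id[OF E w] unfolding R_def W_def CE_def .
  have CEc: "CE x \<in> carrier_mat (N * 2 * work_dim E) (N * 2 * work_dim E)" for x
    unfolding CE_def using E by (intro unitary_carrier unitary_circuit_mat) (auto simp: valid_circuit_def)
  have act: "R x *\<^sub>v embed_state D ?P \<iota> \<phi> = embed_state D ?P \<iota> (\<lambda>p. \<phi> (flip b p))"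
    if eval: "\<forall>k<M. \<forall>z<2. run N E x (ket N (work_dim E) 0 0 ((k * 2 + z) * a)) =
          ket N (work_dim E) 0 0 ((k * 2 + (z + of_bool (b k)) mod 2) * a)" for x b \<phi>
  proof (rule mult_embed_permute)
    show "R x \<in> carrier_mat D D"
      unfolding R_def D_def W_def using tensor_id_carrier[OF CEc] by (simp add: mult.assoc)
    fix p r assume p: "p \<in> ?P" and r: "r < D"
    obtain k z s where p': "p = (k, z, s)" by (metis prod.collapse)
    have k: "k < M" and s: "s \<in> ?S" using p mem unfolding p' by blast+
    let ?d = "N * 2 * work_dim E"
    have in_d: "pos k z' < ?d" for z' using pos_less[OF k, of z'] N by (simp add: less_le_trans)
    have r_div: "r div w < ?d" using r w by (simp add: D_def W_def less_mult_imp_div_less mult.assoc)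
    have "CE x *\<^sub>v unit_vec ?d (pos k z) = run N E x (ket N (work_dim E) 0 0 (pos k z))"
      using run_eq_circuit_mat[OF E, of "unit_vec ?d (pos k z)"] by (simp add: CE_def ket_def)
    also have "\<dots> = unit_vec ?d (pos k (z \<noteq> b k))"
      using eval[rule_format, OF k, of "of_bool z"]
      by (cases z; cases "b k") (simp_all add: pos_def ket_def)
    finally have "(CE x *\<^sub>v unit_vec ?d (pos k z)) $ (r div w) = of_bool (r div w = pos k (z \<noteq> b k))"
      using r_div in_d by (simp del: index_mult_mat_vec)
    moreover have "(CE x *\<^sub>v unit_vec ?d (pos k z)) $ (r div w) = CE x $$ (r div w, pos k z)"
      using CEc[of x] in_d r_div by (simp add: scalar_prod_right_unit)
    moreover have "R x $$ (r, \<iota> p) = (if r mod w = e s then CE x $$ (r div w, pos k z) else 0)"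
      unfolding R_def
    proof (subst tensor_id_index[OF CEc])
      show "r < ?d * w" using r by (simp add: D_def W_def mult.assoc)
      show "\<iota> p < ?d * w" using range_less[OF p] N by (simp add: W_def less_le_trans mult.assoc)
    qed (simp add: p' div_mod[OF s])
    moreover have "r = \<iota> (flip b p) \<longleftrightarrow> r mod w = e s \<and> r div w = pos k (z \<noteq> b k)"
      using div_mod[OF s, of k "z \<noteq> b k"] by (auto simp: p' flip_def) (metis div_mult_mod_eq)
    ultimately show "R x $$ (r, \<iota> p) = of_bool (r = \<iota> (flip b p))" by auto
  qed (use P range in \<open>auto simp: D_def flip_registers flip_flip\<close>)

  obtain G where G: "realizable N W (K * queries E) G" and evolve:
    "\<And>x b. b \<in> X \<Longrightarrow> (\<And>\<phi>. R x *\<^sub>v embed_state D ?P \<iota> \<phi> = embed_state D ?P \<iota> (\<lambda>p. \<phi> (flip b p))) \<Longrightarrow>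
      G x *\<^sub>v embed_state D ?P \<iota> (ideal_state K F u v 0 b) = embed_state D ?P \<iota> (ideal_state K F u v K b)"
    using realizable_ideal_evolution[OF W R sol X M inj range order_refl[of K]] unfolding D_def by blast

  \<comment> \<open>The public part at time 0 without the catalyst. A reflection \<open>U0\<close>
    prepares it from the prescribed start state.\<close>
  define init :: "nat \<times> bool \<times> ('g option + bool \<times> nat) \<Rightarrow> real" where
    "init = (\<lambda>(k, z, s). of_bool (k = 0 \<and> s = Inl None) * sqrt (1 / 2))"
  have "(\<Sum>p\<in>?P. init p * init p) = 1"
  proof -
    have "(\<Sum>p\<in>?P. init p * init p) = (\<Sum>p\<in>{0} \<times> UNIV \<times> {Inl None}. init p * init p)"
      by (rule sum.mono_neutral_right[OF P]) (use M in \<open>auto simp: registers_def init_def\<close>)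
    then show ?thesis by (simp add: sum_Sigma_nested init_def UNIV_bool)
  qed
  then have "cdot D (unit_vec D 0) (unit_vec D 0) = cdot D (embed_state D ?P \<iota> init) (embed_state D ?P \<iota> init)"
  proof -
    have "cdot D (unit_vec D 0) (unit_vec D 0) = (\<Sum>r<D. if r = 0 then 1 else 0)"
      unfolding cdot_def by (intro sum.cong) auto
    then have "cdot D (unit_vec D 0) (unit_vec D 0) = 1" using N W by (simp add: D_def)
    moreover have "cdot D (embed_state D ?P \<iota> init) (embed_state D ?P \<iota> init) = complex_of_real (\<Sum>p\<in>?P. init p * init p)"
      by (rule cdot_embed[OF P inj]) (use range in \<open>simp add: D_def\<close>)
    ultimately show ?thesis using \<open>(\<Sum>p\<in>?P. init p * init p) = 1\<close> by simp
  qed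
  from unitary_reflection[OF unit_vec_carrier embed_state_carrier this]
  obtain U0 where U0: "unitary D U0" "U0 *\<^sub>v unit_vec D 0 = embed_state D ?P \<iota> init" by blast
  have "realizable N W (0 + K * queries E) (\<lambda>x. G x * U0)"
    by (rule realizable_mult[OF W realizable_const G]) (use U0 in \<open>simp add: D_def\<close>)
  then obtain F0 L0 where ops: "\<forall>U\<in>insert F0 (set L0). unitary D U" "length L0 = K * queries E"
    and mat: "\<And>x. circuit_mat N W F0 L0 x = G x * U0"
    unfolding realizable_def D_def by auto
  \<comment> \<open>At positions without an output label the decoded value is arbitrary; the ideal
    final state has no public amplitude there.\<close>
  define out where "out r = sel (SOME y. \<exists>z. (0, z, Inl (Some y)) \<in> ?P \<and> r = \<iota> (0, z, Inl (Some y)))" for r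
  define A :: "'o query_algorithm" where
    "A = \<lparr>work_dim = W, first_op = F0, later_ops = L0, output_of = out\<rparr>"
  have valid: "valid_circuit N A" using N W ops by (simp add: valid_circuit_def A_def D_def)
  have GU: "run N A x (ket N (work_dim A) 0 0 0) = G x *\<^sub>v embed_state D ?P \<iota> init" for x
  proof -
    have "run N A x (ket N (work_dim A) 0 0 0) = (G x * U0) *\<^sub>v unit_vec D 0"
      using run_eq_circuit_mat[OF valid, of "ket N (work_dim A) 0 0 0"] mat[of x]
      by (simp add: A_def ket_def D_def)
    also have "\<dots> = G x *\<^sub>v (U0 *\<^sub>v unit_vec D 0)"
      using unitary_carrier[OF realizable_unitary[OF W G]] unitary_carrier[OF U0(1)]
      by (intro assoc_mult_mat_vec[of _ D D _ D]) (auto simp: D_def)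
    finally show ?thesis by (simp add: U0)
  qed
  have err: "error_prob N A x C \<le> 0.1"
    if b: "b \<in> X" and sel: "sel (F b) \<in> C" and
      eval: "\<forall>k<M. \<forall>z<2. run N E x (ket N (work_dim E) 0 0 ((k * 2 + z) * a)) =
          ket N (work_dim E) 0 0 ((k * 2 + (z + of_bool (b k)) mod 2) * a)" for x b C
  proof -
    let ?e = "embed_state D ?P \<iota> (\<lambda>p. catalyst u v b p / sqrt K)"
    let ?B = "{r. r < D \<and> out r \<notin> C}"
    have "embed_state D ?P \<iota> (ideal_state K F u v 0 b) = embed_state D ?P \<iota> init + ?e"
      unfolding embed_state_add[symmetric]
      by (rule embed_state_cong) (auto simp: ideal_state_def public_part_def init_def split: sum.split option.split)
    then have fin: "G x *\<^sub>v (embed_state D ?P \<iota> init + ?e) = embed_state D ?P \<iota> (ideal_state K F u v K b)"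
      using evolve[OF b act[OF eval]] by simp
    have "(\<Sum>r\<in>?B. (cmod ((G x *\<^sub>v embed_state D ?P \<iota> init) $ r))\<^sup>2) \<le> 4 * (c / 2 / K)"
    proof (rule order_trans[OF perturbed_output_bound[where e = ?e]])
      show "unitary D (G x)" using realizable_unitary[OF W G] by (simp add: D_def)
      show "cdot D ?e ?e = complex_of_real (\<Sum>p\<in>?P. catalyst u v b p / sqrt K * (catalyst u v b p / sqrt K))"
        by (rule cdot_embed[OF P inj]) (use range in \<open>simp add: D_def\<close>)
      have "(\<Sum>p\<in>?P. catalyst u v b p / sqrt K * (catalyst u v b p / sqrt K)) =
          (\<Sum>p\<in>?P. (catalyst u v b p)\<^sup>2) / K"
        by (simp add: sum_divide_distrib power2_eq_square)
      also have "\<dots> \<le> c / 2 / K"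
        using catalyst_norm[OF sol X b] by (intro divide_right_mono) auto
      finally show "4 * (\<Sum>p\<in>?P. catalyst u v b p / sqrt K * (catalyst u v b p / sqrt K)) \<le> 4 * (c / 2 / K)"
        by simp
      fix r assume r: "r \<in> ?B"
      \<comment> \<open>At weight 1 the whole public part sits on the label of \<open>F b\<close>,
        whose positions decode to a correct output.\<close>
      have zero: "public_part 1 (F b) p = 0" if p: "p \<in> ?P" "\<iota> p = r" for p
      proof (rule ccontr)
        assume "public_part 1 (F b) p \<noteq> 0"
        then obtain z where pz: "p = (0, z, Inl (Some (F b)))"
          by (cases p) (auto simp: public_part_def split: sum.splits option.splits)
        have "y = F b" if y: "(0, z', Inl (Some y)) \<in> ?P \<and> r = \<iota> (0, z', Inl (Some y))" for y z'
        proof -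
          have "(0, z', Inl (Some y)) = p" using inj_onD[OF inj] y p by metis
          then show ?thesis using pz by simp
        qed
        moreover have "\<exists>z. (0, z, Inl (Some (F b))) \<in> ?P \<and> r = \<iota> (0, z, Inl (Some (F b)))"
          using p pz by auto
        ultimately have "(SOME y. \<exists>z. (0, z, Inl (Some y)) \<in> ?P \<and> r = \<iota> (0, z, Inl (Some y))) = F b"
          by (intro some_equality) auto
        then have "out r \<in> C" using sel by (simp add: out_def)
        then show False using r by simp
      qed
      show "(G x *\<^sub>v (embed_state D ?P \<iota> init + ?e)) $ r = ?e $ r"
      proof -
        have "r < D" "real K / real K = 1" using r K(2) by auto
        then show ?thesis
          unfolding fin by (auto simp: embed_state_index ideal_state_def zero intro!: sum.cong)
      qed
    qed auto
    also have "\<dots> \<le> 0.1" using K by (simp add: field_simps)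
    finally show ?thesis
      unfolding error_prob_def GU by (simp add: A_def D_def)
  qed
  have "queries A = K * queries E" using ops by (simp add: queries_def A_def)
  then show ?thesis using valid err by blast
qed

section \<open>The iteration count and the algorithm for the largest empty square\<close>

definition iterations :: "nat \<Rightarrow> nat" where
  "iterations n = nat \<lceil>20 * ((real (nat \<lceil>log 2 (real n + 1)\<rceil>) + 1) * (40 * real n * sqrt n))\<rceil> + 1"

text \<open>Replacing both roundings by additive constants leaves an expression of order n^1.5 log
  n. Since \<open>ln (ln n)\<close> tends to infinity, the claimed bound dominates it.\<close>

lemma iterations_bigo:
  "(\<lambda>n. real (iterations n)) \<in> O(\<lambda>n. real n powr 1.5 * ln (real n) * ln (ln (real n)))"
proof (rule landau_o.big_trans)
  show "(\<lambda>n. real (iterations n)) \<in> O(\<lambda>n. 800 * ((log 2 (real n + 1) + 2) * (real n * sqrt n)) + 2)"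
  proof (intro landau_o.big_mono always_eventually allI)
    fix n
    let ?k = "nat \<lceil>log 2 (real n + 1)\<rceil>"
    let ?c = "20 * ((real ?k + 1) * (40 * real n * sqrt n))"
    have "0 \<le> log 2 (real n + 1)" by simp
    then have "real ?k \<le> log 2 (real n + 1) + 1" by linarith
    then have "real ?k + 1 \<le> log 2 (real n + 1) + 2" by linarith
    then have "(real ?k + 1) * (real n * sqrt n) \<le> (log 2 (real n + 1) + 2) * (real n * sqrt n)"
      by (rule mult_right_mono) simp
    moreover have "?c = 800 * ((real ?k + 1) * (real n * sqrt n))" by (simp only: mult_ac)
    ultimately have "?c \<le> 800 * ((log 2 (real n + 1) + 2) * (real n * sqrt n))" by linarith
    moreover have "real (nat \<lceil>?c\<rceil>) \<le> ?c + 1"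
    proof -
      have "0 \<le> ?c"
        by (intro mult_nonneg_nonneg add_nonneg_nonneg of_nat_0_le_iff real_sqrt_ge_zero) simp_all
      then show ?thesis by linarith
    qed
    ultimately have "real (iterations n) \<le> 800 * ((log 2 (real n + 1) + 2) * (real n * sqrt n)) + 2"
      by (simp add: iterations_def)
    then show "norm (real (iterations n)) \<le> norm (800 * ((log 2 (real n + 1) + 2) * (real n * sqrt n)) + 2)"
      by simp
  qed
  show "(\<lambda>n. 800 * ((log 2 (real n + 1) + 2) * (real n * sqrt n)) + 2) \<in>
      O(\<lambda>n. real n powr 1.5 * ln (real n) * ln (ln (real n)))"
    by real_asymp
qed

lemma LSQR_cong:
  assumes "\<And>i j. i < n \<Longrightarrow> j < n \<Longrightarrow> f i j = g i j"
  shows "LSQR f n = LSQR g n"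
proof -
  have "empty_square n f = empty_square n g"
    using assms unfolding empty_square_def fun_eq_iff by (intro allI conj_cong refl ball_cong) auto
  then show ?thesis by (simp only: LSQR_def)
qed

text \<open>The circuit may depend on \<open>E\<close> but has to serve every input \<open>x\<close>
  and every \<open>f\<close> that \<open>E\<close> evaluates on it; the adversary input is the truth
  table of \<open>f\<close>.\<close>

lemma lsqr_algorithm:
  assumes n: "1 \<le> n" and E: "valid_circuit N E"
  shows "\<exists>A :: (nat \<times> nat \<times> nat) option query_algorithm. valid_circuit N A \<and>
    queries A \<le> iterations n * queries E \<and>
    (\<forall>x f. coherently_evaluates N E x n f \<longrightarrow> error_prob N A x (LSQR f n) \<le> 0.1)"
proof (cases "\<exists>a. work_dim E = n * n * 2 * a")
  case False
  let ?A = "\<lparr>work_dim = 1, first_op = 1\<^sub>m (N * 2), later_ops = [], output_of = \<lambda>_. None\<rparr>"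
  have "valid_circuit N ?A" using E by (simp add: valid_circuit_def unitary_one)
  then show ?thesis using False
    by (intro exI[of _ ?A]) (auto simp: coherently_evaluates_def queries_def)
next
  case True
  then obtain a where dim: "work_dim E = n * n * 2 * a" by blast
  \<comment> \<open>Truth tables padded with \<open>False\<close>: fixing the bits beyond
    \<open>n * n\<close> makes the set of adversary inputs finite.\<close>
  define X where "X = {x :: nat \<Rightarrow> bool. \<forall>k\<ge>n * n. \<not> x k}"
  have "X \<subseteq> (\<lambda>S k. k \<in> S) ` Pow {..<n * n}"
  proof
    fix x assume "x \<in> X"
    then have "{k. x k} \<in> Pow {..<n * n}" by (auto simp: X_def not_le[symmetric])
    then show "x \<in> (\<lambda>S k. k \<in> S) ` Pow {..<n * n}" by (intro image_eqI[of _ _ "{k. x k}"]) auto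
  qed
  then have X: "finite X" by (rule finite_subset) simp
  \<comment> \<open>The side takes one of the \<open>n + 1\<close> values from 0 to
    \<open>n\<close>, so this many comparisons determine it.\<close>
  define k where "k = nat \<lceil>log 2 (real n + 1)\<rceil>"
  have "n < 2 ^ k"
  proof -
    have "log 2 (real n + 1) \<le> real k" unfolding k_def by linarith
    then have "real n + 1 \<le> 2 powr real k" by (simp add: log_le_iff)
    then have "real (n + 1) \<le> real (2 ^ k)" by (simp add: powr_realpow add.commute)
    then show ?thesis unfolding of_nat_le_iff by simp
  qed
  obtain sel where sel: "\<And>x. sel (solution_data n x) \<in> LSQR (grid n x) n"
    using solution_data_correct[of n] by metis
  \<comment> \<open>\<open>iterations\<close> is 20 times the cost in
    \<open>adv_solution_data\<close>, rounded up; the final \<open>+ 1\<close> keeps it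
    positive.\<close>
  have K: "20 * ((real k + 1) * (40 * real n * sqrt n)) \<le> real (iterations n)" "0 < iterations n"
    unfolding iterations_def k_def by linarith+
  obtain A :: "(nat \<times> nat \<times> nat) option query_algorithm" where
    A: "valid_circuit N A" "queries A = iterations n * queries E" and
    err: "\<And>x b C. b \<in> X \<Longrightarrow>
       \<forall>k<n * n. \<forall>z<2. run N E x (ket N (work_dim E) 0 0 ((k * 2 + z) * a)) =
          ket N (work_dim E) 0 0 ((k * 2 + (z + of_bool (b k)) mod 2) * a) \<Longrightarrow>
       sel (solution_data n b) \<in> C \<Longrightarrow> error_prob N A x C \<le> 0.1"
    using adversary_algorithm[OF E dim X adv_solution_data[OF X \<open>n < 2 ^ k\<close>] K, of sel] by blast
  have "error_prob N A x (LSQR f n) \<le> 0.1" if coh: "coherently_evaluates N E x n f" for x f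
  proof (rule err)
    let ?b = "\<lambda>k. k < n * n \<and> f (k div n) (k mod n)"
    show "?b \<in> X" by (simp add: X_def)
    have "LSQR (grid n ?b) n = LSQR f n"
      by (rule LSQR_cong) (simp add: grid_def pair_index_less)
    then show "sel (solution_data n ?b) \<in> LSQR f n" using sel by metis
    obtain a' where a': "work_dim E = n * n * 2 * a'" and
      eval: "\<And>i j z. i < n \<Longrightarrow> j < n \<Longrightarrow> z < 2 \<Longrightarrow>
        run N E x (ket N (work_dim E) 0 0 (((i * n + j) * 2 + z) * a')) =
        ket N (work_dim E) 0 0 (((i * n + j) * 2 + (z + of_bool (f i j)) mod 2) * a')"
      using coh unfolding coherently_evaluates_def by blast
    have "a' = a" using dim a' n by simp
    then show "\<forall>k<n * n. \<forall>z<2. run N E x (ket N (work_dim E) 0 0 ((k * 2 + z) * a)) =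
          ket N (work_dim E) 0 0 ((k * 2 + (z + of_bool (?b k)) mod 2) * a)"
    proof (intro allI impI)
      fix k z :: nat assume "k < n * n" "z < 2"
      then show "run N E x (ket N (work_dim E) 0 0 ((k * 2 + z) * a)) =
          ket N (work_dim E) 0 0 ((k * 2 + (z + of_bool (?b k)) mod 2) * a)"
        using eval[of "k div n" "k mod n" z] n \<open>a' = a\<close> by (simp add: less_mult_imp_div_less)
    qed
  qed
  then show ?thesis using A by (intro exI[of _ A]) auto
qed

theorem theorem4:
  shows "\<exists>(A :: nat \<Rightarrow> nat \<Rightarrow> query_circuit \<Rightarrow> (nat \<times> nat \<times> nat) option query_algorithm)
          (q :: nat \<Rightarrow> real).
    q \<in> O(\<lambda>n. real n powr 1.5 * ln (real n) * ln (ln (real n))) \<and>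
    (\<forall>n\<ge>1. \<forall>N E. valid_circuit N E \<longrightarrow>
       valid_circuit N (A n N E) \<and>
       real (queries (A n N E)) \<le> q n * real (queries E) \<and>
       (\<forall>x f. coherently_evaluates N E x n f \<longrightarrow>
          error_prob N (A n N E) x (LSQR f n) \<le> 0.1))"
proof -
  obtain A :: "nat \<Rightarrow> nat \<Rightarrow> query_circuit \<Rightarrow> (nat \<times> nat \<times> nat) option query_algorithm" where
    A: "\<And>n N E. 1 \<le> n \<Longrightarrow> valid_circuit N E \<Longrightarrow> valid_circuit N (A n N E) \<and>
      queries (A n N E) \<le> iterations n * queries E \<and>
      (\<forall>x f. coherently_evaluates N E x n f \<longrightarrow> error_prob N (A n N E) x (LSQR f n) \<le> 0.1)"
    using lsqr_algorithm by metis
  have "real (queries (A n N E)) \<le> real (iterations n) * real (queries E)"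
    if "1 \<le> n" "valid_circuit N E" for n N E
    using A[OF that] by (simp flip: of_nat_mult)
  then show ?thesis
    using A iterations_bigo by (intro exI[of _ A] exI[of _ "\<lambda>n. real (iterations n)"]) blast
qed

end
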